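(* Let $A$ be an $M$-approximately unital Banach algebra. Any $x\in A$ with $\|x\|<1$ may be written as $x=a-b$ with $a,b\in{\mathfrak r}_A$, $\|a\|<1$ and $\|b\|<1$. In fact one may choose such $a,b$ to also lie in $\frac12{\mathfrak F}_A$.
   Context: Banach algebras are complex with submultiplicative norm; "unital" means identity of norm 1. $A$ is approximately unital if it has a contractive approximate identity. Its multiplier unitization $A^1$ is $A$ if $A$ is unital, otherwise $A+\mathbb{C}1$ with $\|a+\lambda1\|=\sup\{\|ac+\lambda c\|:c\in A,\|c\|\le1\}$. ${\mathfrak F}_A=\{a\in A:\|1-a\|_{A^1}\le1\}$, so $\frac12{\mathfrak F}_A=\{a\in A:\|1-2a\|_{A^1}\le1\}$. ${\mathfrak r}_A=\{a\in A:\mathrm{Re}\,\varphi(a)\ge0$ for all $\varphi\in(A^1)^*$ with $\|\varphi\|=\varphi(1)=1\}$. A subspace $E$ of a Banach space $X$ is an $M$-ideal if there is a projection $P$ of $X^{**}$ onto $E^{\perp\perp}$ with $\|\eta\|=\max\{\|P\eta\|,\|\eta-P\eta\|\}$ for all $\eta\in X^{**}$. $A$ is $M$-approximately unital if it is approximately unital and $A$ is an $M$-ideal in $A^1$. *)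

theory Defs
  imports "HOL-Analysis.Analysis"
begin

text \<open>A complex Banach algebra is modelled as a type of sort
  real_normed_algebra + banach (real Banach space with associative, bilinear,
  submultiplicative multiplication; no unit required) together with a
  complex scalar multiplication sc extending scaleR, compatible with the
  multiplication and with the norm (norm (sc c x) = cmod c * norm x).\<close>

definition complex_banach_algebra ::
  "(complex \<Rightarrow> 'a::{real_normed_algebra,banach} \<Rightarrow> 'a) \<Rightarrow> bool" where
  "complex_banach_algebra sc \<longleftrightarrow>
     (\<forall>r x. sc (complex_of_real r) x = scaleR r x) \<and>
     (\<forall>c d x. sc (c + d) x = sc c x + sc d x) \<and>
     (\<forall>c x y. sc c (x + y) = sc c x + sc c y) \<and>
     (\<forall>c d x. sc (c * d) x = sc c (sc d x)) \<and>
     (\<forall>x. sc 1 x = x) \<and>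
     (\<forall>c x. norm (sc c x) = cmod c * norm x) \<and>
     (\<forall>c x y. sc c (x * y) = sc c x * y) \<and>
     (\<forall>c x y. sc c (x * y) = x * sc c y)"

definition unital_alg :: "'a::real_normed_algebra itself \<Rightarrow> bool" where
  "unital_alg _ \<longleftrightarrow> (\<exists>e::'a. norm e = 1 \<and> (\<forall>x. e * x = x \<and> x * e = x))"

definition alg_unit :: "'a::real_normed_algebra" where
  "alg_unit = (THE e. norm e = 1 \<and> (\<forall>x. e * x = x \<and> x * e = x))"

text \<open>Contractive approximate identity, as a net given by a proper filter F
  on A (the pushforward of the indexing net) that lives in the closed unit ball.\<close>
definition approx_unital :: "'a::real_normed_algebra itself \<Rightarrow> bool" where
  "approx_unital _ \<longleftrightarrow> (\<exists>F :: 'a filter. F \<noteq> bot \<and> F \<le> principal {e. norm e \<le> 1} \<and>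
      (\<forall>a. ((\<lambda>e. e * a) \<longlongrightarrow> a) F \<and> ((\<lambda>e. a * e) \<longlongrightarrow> a) F))"

text \<open>Multiplier unitization A^1: the element a + \<lambda>1 is represented by the
  pair (a, \<lambda>).  If A is unital, A^1 = A and (a,\<lambda>) stands for a + \<lambda>e
  (so the representation is by a seminorm whose quotient is A).\<close>
definition u1_norm :: "(complex \<Rightarrow> 'a::real_normed_algebra \<Rightarrow> 'a) \<Rightarrow> 'a \<times> complex \<Rightarrow> real" where
  "u1_norm sc u = (if unital_alg TYPE('a) then norm (fst u + sc (snd u) alg_unit)
      else Sup {norm (fst u * c + sc (snd u) c) | c. norm c \<le> 1})"

definition u1_scale :: "(complex \<Rightarrow> 'a \<Rightarrow> 'a) \<Rightarrow> complex \<Rightarrow> 'a \<times> complex \<Rightarrow> 'a \<times> complex" where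
  "u1_scale sc c u = (sc c (fst u), c * snd u)"

definition u1_dual :: "(complex \<Rightarrow> 'a::real_normed_algebra \<Rightarrow> 'a) \<Rightarrow> ('a \<times> complex \<Rightarrow> complex) set" where
  "u1_dual sc = {\<phi>. (\<forall>u v. \<phi> (u + v) = \<phi> u + \<phi> v) \<and> (\<forall>c u. \<phi> (u1_scale sc c u) = c * \<phi> u) \<and>
      (\<exists>K. \<forall>u. cmod (\<phi> u) \<le> K * u1_norm sc u)}"

definition dual_norm :: "(complex \<Rightarrow> 'a::real_normed_algebra \<Rightarrow> 'a) \<Rightarrow> ('a \<times> complex \<Rightarrow> complex) \<Rightarrow> real" where
  "dual_norm sc \<phi> = Sup {cmod (\<phi> u) | u. u1_norm sc u \<le> 1}"

text \<open>Bounded complex-linear functionals on the dual (the bidual space); they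
  are only meaningful on u1_dual sc.\<close>
definition u1_bidual :: "(complex \<Rightarrow> 'a::real_normed_algebra \<Rightarrow> 'a) \<Rightarrow> (('a \<times> complex \<Rightarrow> complex) \<Rightarrow> complex) set" where
  "u1_bidual sc = {\<eta>. (\<forall>\<phi>\<in>u1_dual sc. \<forall>\<psi>\<in>u1_dual sc. \<eta> (\<lambda>u. \<phi> u + \<psi> u) = \<eta> \<phi> + \<eta> \<psi>) \<and>
      (\<forall>\<phi>\<in>u1_dual sc. \<forall>c. \<eta> (\<lambda>u. c * \<phi> u) = c * \<eta> \<phi>) \<and>
      (\<exists>K. \<forall>\<phi>\<in>u1_dual sc. cmod (\<eta> \<phi>) \<le> K * dual_norm sc \<phi>)}"

definition bidual_norm :: "(complex \<Rightarrow> 'a::real_normed_algebra \<Rightarrow> 'a) \<Rightarrow> (('a \<times> complex \<Rightarrow> complex) \<Rightarrow> complex) \<Rightarrow> real" where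
  "bidual_norm sc \<eta> = Sup {cmod (\<eta> \<phi>) | \<phi>. \<phi> \<in> u1_dual sc \<and> dual_norm sc \<phi> \<le> 1}"

text \<open>A (embedded as pairs (a,0)) is an M-ideal in A^1: there is a linear
  projection P of (A^1)** onto A^{\<perp>\<perp>} with norm(\<eta>) = max(norm(P\<eta>), norm(\<eta>-P\<eta>)).
  Elements of the bidual are compared on the dual only.\<close>
definition annih2 :: "(complex \<Rightarrow> 'a::real_normed_algebra \<Rightarrow> 'a) \<Rightarrow> (('a \<times> complex \<Rightarrow> complex) \<Rightarrow> complex) set" where
  "annih2 sc = {\<eta> \<in> u1_bidual sc. \<forall>\<psi>\<in>u1_dual sc. (\<forall>a. \<psi> (a, 0) = 0) \<longrightarrow> \<eta> \<psi> = 0}"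

definition M_ideal_in_u1 :: "(complex \<Rightarrow> 'a::real_normed_algebra \<Rightarrow> 'a) \<Rightarrow> bool" where
  "M_ideal_in_u1 sc \<longleftrightarrow> (\<exists>P. (\<forall>\<eta>\<in>u1_bidual sc. P \<eta> \<in> annih2 sc) \<and>
     (\<forall>\<zeta>\<in>annih2 sc. \<exists>\<eta>\<in>u1_bidual sc. \<forall>\<phi>\<in>u1_dual sc. P \<eta> \<phi> = \<zeta> \<phi>) \<and>
     (\<forall>\<eta>\<in>u1_bidual sc. \<forall>\<phi>\<in>u1_dual sc. P (P \<eta>) \<phi> = P \<eta> \<phi>) \<and>
     (\<forall>\<eta>\<in>u1_bidual sc. \<forall>\<zeta>\<in>u1_bidual sc. \<forall>\<phi>\<in>u1_dual sc.
         P (\<lambda>\<psi>. \<eta> \<psi> + \<zeta> \<psi>) \<phi> = P \<eta> \<phi> + P \<zeta> \<phi>) \<and>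
     (\<forall>\<eta>\<in>u1_bidual sc. \<forall>c. \<forall>\<phi>\<in>u1_dual sc. P (\<lambda>\<psi>. c * \<eta> \<psi>) \<phi> = c * P \<eta> \<phi>) \<and>
     (\<forall>\<eta>\<in>u1_bidual sc. bidual_norm sc \<eta> =
         max (bidual_norm sc (P \<eta>)) (bidual_norm sc (\<lambda>\<psi>. \<eta> \<psi> - P \<eta> \<psi>))))"

definition M_approx_unital :: "(complex \<Rightarrow> 'a::real_normed_algebra \<Rightarrow> 'a) \<Rightarrow> bool" where
  "M_approx_unital sc \<longleftrightarrow> approx_unital TYPE('a) \<and> M_ideal_in_u1 sc"

definition u1_state :: "(complex \<Rightarrow> 'a::real_normed_algebra \<Rightarrow> 'a) \<Rightarrow> ('a \<times> complex \<Rightarrow> complex) \<Rightarrow> bool" where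
  "u1_state sc \<phi> \<longleftrightarrow> \<phi> \<in> u1_dual sc \<and> dual_norm sc \<phi> = 1 \<and> \<phi> (0, 1) = 1"

definition r_set :: "(complex \<Rightarrow> 'a::real_normed_algebra \<Rightarrow> 'a) \<Rightarrow> 'a set" where
  "r_set sc = {a. \<forall>\<phi>. u1_state sc \<phi> \<longrightarrow> Re (\<phi> (a, 0)) \<ge> 0}"

definition F_set :: "(complex \<Rightarrow> 'a::real_normed_algebra \<Rightarrow> 'a) \<Rightarrow> 'a set" where
  "F_set sc = {a. u1_norm sc (- a, 1) \<le> 1}"

definition half_F_set :: "(complex \<Rightarrow> 'a::real_normed_algebra \<Rightarrow> 'a) \<Rightarrow> 'a set" where
  "half_F_set sc = {a. u1_norm sc (- scaleR 2 a, 1) \<le> 1}"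

end

theory Submission
  imports Defs
begin

text \<open>Let \<open>P\<close> be the M-projection of the bidual of \<open>A\<^sup>1\<close> onto the bipolar of \<open>A\<close> and \<open>p = P 1\<close>.
  If \<open>\<parallel>x\<parallel> < 1\<close> then \<open>\<parallel>1 - p \<plusminus> x\<parallel> = max \<parallel>1 - p\<parallel> \<parallel>x\<parallel> \<le> 1\<close>. By Hahn-Banach \<open>p\<close> can be replaced by an
  element \<open>e\<close> of \<open>A\<close> up to an arbitrarily small error, and since \<open>\<parallel>x\<parallel> < 1\<close> strictly, the error can
  be halved repeatedly by corrections of summable size; so some \<open>e\<close> in \<open>A\<close> satisfies
  \<open>\<parallel>1 - e \<plusminus> x\<parallel> \<le> 1\<close>. Then \<open>(e + x) / 2\<close> and \<open>(e - x) / 2\<close> lie in half of \<open>F\<^sub>A\<close>, have norm at most 1 and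
  differ by \<open>x\<close>. Applying this to \<open>x / s\<close> with \<open>\<parallel>x\<parallel> < s < 1\<close> and scaling back by \<open>s\<close> makes the norms
  strictly smaller than 1.\<close>

section \<open>The Hahn-Banach theorem\<close>

text \<open>Homogeneity is asked as an inequality for positive \<open>t\<close>, the form that
  passes easily to infima; applied to \<open>t\<close> and to its inverse it becomes an
  equality.\<close>

definition sublinear :: "('v::real_vector \<Rightarrow> real) \<Rightarrow> bool" where
  "sublinear q \<longleftrightarrow> (\<forall>x y. q (x + y) \<le> q x + q y) \<and> (\<forall>t x. t > 0 \<longrightarrow> q (t *\<^sub>R x) \<le> t * q x)"

lemma sublinear_add: "sublinear q \<Longrightarrow> q (x + y) \<le> q x + q y"
  and sublinear_scale_le: "sublinear q \<Longrightarrow> t > 0 \<Longrightarrow> q (t *\<^sub>R x) \<le> t * q x"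
  by (auto simp: sublinear_def)

lemma sublinear_zero: "sublinear q \<Longrightarrow> q 0 = 0"
  using sublinear_add[of q 0 0] sublinear_scale_le[of q "1/2" 0] by simp

lemma sublinear_scale:
  assumes "sublinear q" "t \<ge> 0"
  shows "q (t *\<^sub>R x) = t * q x"
proof (cases "t = 0")
  case False
  with assms have t: "t > 0" by simp
  have "q (inverse t *\<^sub>R (t *\<^sub>R x)) \<le> inverse t * q (t *\<^sub>R x)"
    using t by (intro sublinear_scale_le assms) simp
  then have "t * q x \<le> q (t *\<^sub>R x)"
    using t by (simp add: field_simps)
  with sublinear_scale_le[OF assms(1) t, of x] show ?thesis by simp
qed (simp add: sublinear_zero[OF assms(1)])

lemma sublinear_lower: "sublinear q \<Longrightarrow> - q (- x) \<le> q x"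
  using sublinear_add[of q x "- x"] sublinear_zero[of q] by simp

text \<open>The largest sublinear functional below \<open>q\<close> taking the value \<open>- q z\<close> at \<open>- z\<close>.\<close>

definition sublinear_descent :: "('v::real_vector \<Rightarrow> real) \<Rightarrow> 'v \<Rightarrow> 'v \<Rightarrow> real" where
  "sublinear_descent q z y = (INF t\<in>{0..}. q (y + t *\<^sub>R z) - t * q z)"

text \<open>Subadditivity bounds the values along the whole ray from below by
  \<open>- q (- y)\<close>, so the infimum in the descent is a genuine one.\<close>

lemma sublinear_descent_bdd:
  assumes "sublinear q"
  shows "bdd_below ((\<lambda>t. q (y + t *\<^sub>R z) - t * q z) ` {0..})"
proof (rule bdd_belowI2)
  fix t :: real assume "t \<in> {0..}"
  then have "t * q z = q (t *\<^sub>R z)" using sublinear_scale[OF assms] by simp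
  also have "\<dots> \<le> q (y + t *\<^sub>R z) + q (- y)"
    using sublinear_add[OF assms, of "y + t *\<^sub>R z" "- y"] by simp
  finally show "- q (- y) \<le> q (y + t *\<^sub>R z) - t * q z" by simp
qed

lemma sublinear_descent_le:
  assumes "sublinear q" "t \<ge> 0"
  shows "sublinear_descent q z y \<le> q (y + t *\<^sub>R z) - t * q z"
  unfolding sublinear_descent_def
  using assms by (intro cINF_lower sublinear_descent_bdd) auto

lemma sublinear_descent_less_witness:
  assumes "sublinear_descent q z y < c"
  obtains t where "t \<ge> 0" "q (y + t *\<^sub>R z) - t * q z < c"
proof -
  have "\<exists>s\<in>(\<lambda>t. q (y + t *\<^sub>R z) - t * q z) ` {0..}. s < c"
    using assms unfolding sublinear_descent_def by (intro cInf_lessD) auto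
  then show ?thesis using that by auto
qed

text \<open>Parameters nearly optimal for \<open>x\<close> and for \<open>y\<close> add up to an
  admissible one for \<open>x + y\<close>, and \<open>r\<close> times one for \<open>x\<close> is
  admissible for \<open>r *\<^sub>R x\<close>.\<close>

lemma sublinear_descent_sublinear:
  assumes q: "sublinear q"
  shows "sublinear (sublinear_descent q z)"
  unfolding sublinear_def
proof (intro conjI allI impI)
  fix x y
  show "sublinear_descent q z (x + y) \<le> sublinear_descent q z x + sublinear_descent q z y"
  proof (rule field_le_epsilon)
    fix e :: real assume "e > 0"
    obtain s where s: "s \<ge> 0" "q (x + s *\<^sub>R z) - s * q z < sublinear_descent q z x + e/2"
      by (rule sublinear_descent_less_witness[of q z x "sublinear_descent q z x + e/2"])
        (use \<open>e > 0\<close> in auto)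
    obtain t where t: "t \<ge> 0" "q (y + t *\<^sub>R z) - t * q z < sublinear_descent q z y + e/2"
      by (rule sublinear_descent_less_witness[of q z y "sublinear_descent q z y + e/2"])
        (use \<open>e > 0\<close> in auto)
    have "sublinear_descent q z (x + y) \<le> q (x + y + (s + t) *\<^sub>R z) - (s + t) * q z"
      using s t by (intro sublinear_descent_le q) auto
    also have "x + y + (s + t) *\<^sub>R z = (x + s *\<^sub>R z) + (y + t *\<^sub>R z)"
      by (simp add: algebra_simps)
    also have "q \<dots> \<le> q (x + s *\<^sub>R z) + q (y + t *\<^sub>R z)" by (rule sublinear_add[OF q])
    finally show "sublinear_descent q z (x + y)
        \<le> sublinear_descent q z x + sublinear_descent q z y + e"
      using s t by (simp add: algebra_simps)
  qed
next
  fix r :: real and x assume r: "r > 0"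
  show "sublinear_descent q z (r *\<^sub>R x) \<le> r * sublinear_descent q z x"
  proof (rule field_le_epsilon)
    fix e :: real assume "e > 0"
    obtain s where s: "s \<ge> 0" "q (x + s *\<^sub>R z) - s * q z < sublinear_descent q z x + e/r"
      by (rule sublinear_descent_less_witness[of q z x "sublinear_descent q z x + e/r"])
        (use \<open>e > 0\<close> r in auto)
    have "sublinear_descent q z (r *\<^sub>R x) \<le> q (r *\<^sub>R x + (r * s) *\<^sub>R z) - (r * s) * q z"
      using s r by (intro sublinear_descent_le q) auto
    also have "r *\<^sub>R x + (r * s) *\<^sub>R z = r *\<^sub>R (x + s *\<^sub>R z)"
      by (simp add: algebra_simps)
    also have "q \<dots> \<le> r * q (x + s *\<^sub>R z)" by (rule sublinear_scale_le[OF q r])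
    finally have "sublinear_descent q z (r *\<^sub>R x) \<le> r * (q (x + s *\<^sub>R z) - s * q z)"
      by (simp add: algebra_simps)
    also have "\<dots> \<le> r * (sublinear_descent q z x + e/r)"
      using s r by (intro mult_left_mono) auto
    finally show "sublinear_descent q z (r *\<^sub>R x) \<le> r * sublinear_descent q z x + e"
      using r by (simp add: algebra_simps)
  qed
qed

text \<open>This supplies the lower bounds of chains for Zorn's lemma. Near-minimisers at two points
  may be different members, but in a chain the smaller one serves both points. The common majorant
  \<open>q\<close> keeps the values above \<open>- q (- x)\<close>.\<close>

lemma sublinear_INF:
  fixes C :: "('v::real_vector \<Rightarrow> real) set"
  assumes "C \<noteq> {}" and sub: "\<And>f. f \<in> C \<Longrightarrow> sublinear f \<and> f \<le> q"
    and chain: "\<And>f g. f \<in> C \<Longrightarrow> g \<in> C \<Longrightarrow> f \<le> g \<or> g \<le> f"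
  shows "sublinear (\<lambda>x. INF f\<in>C. f x)" "\<And>f x. f \<in> C \<Longrightarrow> (INF f\<in>C. f x) \<le> f x"
proof -
  have bdd: "bdd_below ((\<lambda>f. f x) ` C)" for x
  proof (rule bdd_belowI2)
    fix f assume "f \<in> C"
    with sub[of f] sublinear_lower[of f x] show "- q (- x) \<le> f x"
      by (auto simp: le_fun_def intro: order_trans[rotated])
  qed
  show le: "(INF f\<in>C. f x) \<le> f x" if "f \<in> C" for f x
    using that by (intro cINF_lower bdd)
  have wit: "\<exists>f\<in>C. f x < c" if "(INF f\<in>C. f x) < c" for x c
    using cInf_lessD[OF _ that] \<open>C \<noteq> {}\<close> by auto
  show "sublinear (\<lambda>x. INF f\<in>C. f x)"
    unfolding sublinear_def
  proof (intro conjI allI impI)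
    fix x y
    show "(INF f\<in>C. f (x + y)) \<le> (INF f\<in>C. f x) + (INF f\<in>C. f y)"
    proof (rule field_le_epsilon)
      fix e :: real assume "e > 0"
      obtain f where f: "f \<in> C" "f x < (INF f\<in>C. f x) + e/2"
        using wit[of x "(INF f\<in>C. f x) + e/2"] \<open>e > 0\<close> by auto
      obtain g where g: "g \<in> C" "g y < (INF f\<in>C. f y) + e/2"
        using wit[of y "(INF f\<in>C. f y) + e/2"] \<open>e > 0\<close> by auto
      obtain h where h: "h \<in> C" "h x \<le> f x" "h y \<le> g y"
        using chain[OF f(1) g(1)] f(1) g(1) by (auto simp: le_fun_def)
      have "(INF f\<in>C. f (x + y)) \<le> h (x + y)" by (rule le[OF h(1)])
      also have "\<dots> \<le> h x + h y" using sub[OF h(1)] by (auto intro: sublinear_add)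
      finally show "(INF f\<in>C. f (x + y)) \<le> (INF f\<in>C. f x) + (INF f\<in>C. f y) + e"
        using f g h by linarith
    qed
  next
    fix t :: real and x assume t: "t > 0"
    show "(INF f\<in>C. f (t *\<^sub>R x)) \<le> t * (INF f\<in>C. f x)"
    proof (rule field_le_epsilon)
      fix e :: real assume "e > 0"
      obtain f where f: "f \<in> C" "f x < (INF f\<in>C. f x) + e/t"
        using wit[of x "(INF f\<in>C. f x) + e/t"] \<open>e > 0\<close> t by auto
      have "(INF f\<in>C. f (t *\<^sub>R x)) \<le> f (t *\<^sub>R x)" by (rule le[OF f(1)])
      also have "\<dots> \<le> t * f x" using sub[OF f(1)] t by (auto intro: sublinear_scale_le)
      also have "\<dots> \<le> t * ((INF f\<in>C. f x) + e/t)"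
        using f t by (intro mult_left_mono) auto
      finally show "(INF f\<in>C. f (t *\<^sub>R x)) \<le> t * (INF f\<in>C. f x) + e"
        using t by (simp add: algebra_simps)
    qed
  qed
qed

text \<open>A minimal sublinear functional equals each of its descents and is therefore additive.\<close>

lemma linear_below_sublinear:
  fixes q :: "'v::real_vector \<Rightarrow> real"
  assumes q: "sublinear q"
  shows "\<exists>f. linear f \<and> f \<le> q"
proof -
  let ?A = "{f. sublinear f \<and> f \<le> q}"
  have "\<exists>m\<in>?A. \<forall>f\<in>?A. f \<le> m \<longrightarrow> f = m"
  \<comment> \<open>The order is reversed, so that Zorn's lemma delivers a minimal element.\<close>
  proof (rule predicate_Zorn[where P = "\<lambda>f g. g \<le> f"])
    show "partial_order_on ?A (relation_of (\<lambda>f g. g \<le> f) ?A)"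
      by (rule partial_order_on_relation_ofI) auto
  next
    fix C assume C: "C \<in> Chains (relation_of (\<lambda>f g. g \<le> f) ?A)"
    then have sub: "\<And>f. f \<in> C \<Longrightarrow> sublinear f \<and> f \<le> q"
      and chain: "\<And>f g. f \<in> C \<Longrightarrow> g \<in> C \<Longrightarrow> f \<le> g \<or> g \<le> f"
      by (auto simp: Chains_def relation_of_def)
    show "\<exists>u\<in>?A. \<forall>f\<in>C. u \<le> f"
    proof (cases "C = {}")
      case True
      then show ?thesis using q by auto
    next
      case False
      note inf = sublinear_INF[OF False sub chain]
      then have "\<forall>f\<in>C. (\<lambda>x. INF f\<in>C. f x) \<le> f" by (auto simp: le_fun_def)
      moreover from this False sub have "(\<lambda>x. INF f\<in>C. f x) \<le> q" by (meson ex_in_conv order_trans)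
      ultimately show ?thesis using inf(1) by blast
    qed
  qed
  then obtain m where m: "sublinear m" "m \<le> q"
    and min: "\<And>f. sublinear f \<Longrightarrow> f \<le> q \<Longrightarrow> f \<le> m \<Longrightarrow> f = m"
    by auto
  have desc: "sublinear_descent m z = m" for z
  proof (rule min[OF sublinear_descent_sublinear[OF m(1)]])
    show "sublinear_descent m z \<le> m"
      using sublinear_descent_le[OF m(1), of 0 z] by (auto simp: le_fun_def)
    then show "sublinear_descent m z \<le> q" using m(2) by (rule order_trans)
  qed
  \<comment> \<open>The term \<open>t = 1\<close> of the descent gives
    \<open>m y \<le> m (y + z) - m z\<close>, the converse of subadditivity.\<close>
  have add: "m (y + z) = m y + m z" for y z
    using sublinear_descent_le[OF m(1), of 1 z y] sublinear_add[OF m(1), of y z]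
    by (simp add: desc)
  have neg: "m (- y) = - m y" for y
    using add[of y "- y"] sublinear_zero[OF m(1)] by simp
  have "m (t *\<^sub>R y) = t * m y" for t y
  proof (cases "t \<ge> 0")
    case False
    then show ?thesis
      using sublinear_scale[OF m(1), of "- t" y] neg[of "t *\<^sub>R y"] by simp
  qed (simp add: sublinear_scale[OF m(1)])
  with add have "linear m" by (intro linearI) auto
  with m(2) show ?thesis by blast
qed

text \<open>A linear \<open>f\<close> below the descent of \<open>q\<close> along \<open>y\<close>
  satisfies \<open>f (- y) \<le> - q y\<close>, which forces equality at \<open>y\<close>; the term
  \<open>t = 0\<close> of the descent gives domination by \<open>q\<close>.\<close>

theorem Hahn_Banach_sublinear:
  fixes q :: "'v::real_vector \<Rightarrow> real"
  assumes q: "sublinear q"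
  obtains f where "linear f" "\<And>x. f x \<le> q x" "f y = q y"
proof -
  obtain f where f: "linear f" "f \<le> sublinear_descent q y"
    using linear_below_sublinear[OF sublinear_descent_sublinear[OF q]] by blast
  have le: "f x \<le> q x" for x
    using f(2) sublinear_descent_le[OF q, of 0 y x] by (auto simp: le_fun_def intro: order_trans)
  have "f (- y) \<le> - q y"
    using f(2) sublinear_descent_le[OF q, of 1 y "- y"] sublinear_zero[OF q]
    by (auto simp: le_fun_def intro: order_trans)
  then have "f y = q y" using le[of y] linear_neg[OF f(1)] by simp
  with f(1) le that show ?thesis by blast
qed

text \<open>This is the quotient by the range of \<open>\<iota>\<close>: near-optimal
  representatives add and scale, and nonnegativity of \<open>m\<close> keeps the infimum finite. A
  linear functional below it vanishes on that range.\<close>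

lemma sublinear_quotient:
  fixes m :: "'w::real_vector \<Rightarrow> real" and \<iota> :: "'v::real_vector \<Rightarrow> 'w"
  assumes m: "sublinear m" "\<And>u. 0 \<le> m u" and \<iota>: "linear \<iota>"
  shows "sublinear (\<lambda>u. INF a. m (u - \<iota> a))" "(INF a. m (u - \<iota> a)) \<le> m (u - \<iota> a)"
proof -
  show le: "(INF a. m (u - \<iota> a)) \<le> m (u - \<iota> a)" for u a
    using m(2) by (intro cINF_lower bdd_belowI2[of _ 0]) auto
  have wit: "\<exists>a. m (u - \<iota> a) < c" if "(INF a. m (u - \<iota> a)) < c" for u c
    using cInf_lessD[OF _ that] by auto
  show "sublinear (\<lambda>u. INF a. m (u - \<iota> a))"
    unfolding sublinear_def
  proof (intro conjI allI impI)
    fix u v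
    show "(INF a. m (u + v - \<iota> a)) \<le> (INF a. m (u - \<iota> a)) + (INF a. m (v - \<iota> a))"
    proof (rule field_le_epsilon)
      fix e :: real assume "e > 0"
      obtain a where a: "m (u - \<iota> a) < (INF a. m (u - \<iota> a)) + e/2"
        using wit[of u "(INF a. m (u - \<iota> a)) + e/2"] \<open>e > 0\<close> by auto
      obtain b where b: "m (v - \<iota> b) < (INF a. m (v - \<iota> a)) + e/2"
        using wit[of v "(INF a. m (v - \<iota> a)) + e/2"] \<open>e > 0\<close> by auto
      have "(INF a. m (u + v - \<iota> a)) \<le> m (u + v - \<iota> (a + b))" by (rule le)
      also have "u + v - \<iota> (a + b) = (u - \<iota> a) + (v - \<iota> b)" by (simp add: linear_add[OF \<iota>])
      also have "m \<dots> \<le> m (u - \<iota> a) + m (v - \<iota> b)" by (rule sublinear_add[OF m(1)])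
      finally show "(INF a. m (u + v - \<iota> a))
          \<le> (INF a. m (u - \<iota> a)) + (INF a. m (v - \<iota> a)) + e"
        using a b by linarith
    qed
  next
    fix t :: real and u assume t: "t > 0"
    show "(INF a. m (t *\<^sub>R u - \<iota> a)) \<le> t * (INF a. m (u - \<iota> a))"
    proof (rule field_le_epsilon)
      fix e :: real assume "e > 0"
      obtain a where a: "m (u - \<iota> a) < (INF a. m (u - \<iota> a)) + e/t"
        using wit[of u "(INF a. m (u - \<iota> a)) + e/t"] \<open>e > 0\<close> t by auto
      have "(INF a. m (t *\<^sub>R u - \<iota> a)) \<le> m (t *\<^sub>R u - \<iota> (t *\<^sub>R a))" by (rule le)
      also have "t *\<^sub>R u - \<iota> (t *\<^sub>R a) = t *\<^sub>R (u - \<iota> a)"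
        by (simp add: linear_cmul[OF \<iota>] algebra_simps)
      also have "m \<dots> \<le> t * m (u - \<iota> a)" by (rule sublinear_scale_le[OF m(1) t])
      also have "\<dots> \<le> t * ((INF a. m (u - \<iota> a)) + e/t)"
        using a t by (intro mult_left_mono) auto
      finally show "(INF a. m (t *\<^sub>R u - \<iota> a)) \<le> t * (INF a. m (u - \<iota> a)) + e"
        using t by (simp add: algebra_simps)
    qed
  qed
qed

section \<open>The multiplier unitization and its dual\<close>

locale approx_unital_algebra =
  fixes sc :: "complex \<Rightarrow> 'a::{real_normed_algebra,banach} \<Rightarrow> 'a"
  assumes cba: "complex_banach_algebra sc"
    and approx_unital: "approx_unital TYPE('a)"
begin

abbreviation "N \<equiv> u1_norm sc"

lemma
  shows sc_of_real: "sc (complex_of_real r) x = r *\<^sub>R x"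
    and sc_add_left: "sc (c + d) x = sc c x + sc d x"
    and sc_add_right: "sc c (x + y) = sc c x + sc c y"
    and sc_sc: "sc c (sc d x) = sc (c * d) x"
    and sc_one: "sc 1 x = x"
    and norm_sc: "norm (sc c x) = cmod c * norm x"
    and sc_mult_left: "sc c x * y = sc c (x * y)"
  using cba by (auto simp: complex_banach_algebra_def)

lemma sc_zero_left: "sc 0 x = 0"
  using sc_of_real[of 0 x] by simp

lemma u1_scale_of_real: "u1_scale sc (complex_of_real r) u = r *\<^sub>R u"
  by (cases u) (simp add: u1_scale_def sc_of_real scaleR_conv_of_real)

lemma u1_scale_scale: "u1_scale sc c (u1_scale sc d u) = u1_scale sc (c * d) u"
  by (simp add: u1_scale_def sc_sc mult.assoc)

lemma u1_scale_one: "u1_scale sc 1 u = u"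
  by (simp add: u1_scale_def sc_one)

lemma u1_scale_add_left: "u1_scale sc (c + d) u = u1_scale sc c u + u1_scale sc d u"
  by (simp add: u1_scale_def sc_add_left algebra_simps)

lemma u1_scale_add_right: "u1_scale sc c (u + v) = u1_scale sc c u + u1_scale sc c v"
  by (simp add: u1_scale_def sc_add_right algebra_simps)

lemma action_bound:
  assumes "norm c \<le> 1"
  shows "norm (fst u * c + sc (snd u) c) \<le> norm (fst u) + cmod (snd u)"
proof -
  have "norm (fst u * c + sc (snd u) c) \<le> norm (fst u * c) + norm (sc (snd u) c)"
    by (rule norm_triangle_ineq)
  also have "norm (fst u * c) \<le> norm (fst u) * norm c" by (rule norm_mult_ineq)
  also have "\<dots> \<le> norm (fst u)" using assms by (simp add: mult_left_le)
  also have "norm (sc (snd u) c) \<le> cmod (snd u)" using assms by (simp add: norm_sc mult_left_le)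
  finally show ?thesis by simp
qed

text \<open>Guarantees that the supremum defining the unitization norm is not a default
  value.\<close>

lemma action_bdd: "bdd_above {norm (fst u * c + sc (snd u) c) | c. norm c \<le> 1}"
  using action_bound by (auto intro!: bdd_aboveI)

text \<open>The unital case needs no separate treatment: the supremum is then attained at the unit.\<close>

lemma N_eq_Sup: "N u = Sup {norm (fst u * c + sc (snd u) c) | c. norm c \<le> 1}"
proof (cases "unital_alg TYPE('a)")
  case True
  then obtain e :: 'a where e: "norm e = 1" "\<And>x. e * x = x" "\<And>x. x * e = x"
    by (auto simp: unital_alg_def)
  have "alg_unit = e"
    unfolding alg_unit_def
  proof (rule the_equality)
    fix d :: 'a assume "norm d = 1 \<and> (\<forall>x. d * x = x \<and> x * d = x)"
    then show "d = e" using e(3)[of d] by metis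
  qed (use e in auto)
  then have N: "N u = norm (fst u + sc (snd u) e)"
    using True by (simp add: u1_norm_def)
  also have "\<dots> = Sup {norm (fst u * c + sc (snd u) c) | c. norm c \<le> 1}"
  proof (rule cSup_eq_maximum[symmetric])
    show "norm (fst u + sc (snd u) e) \<in> {norm (fst u * c + sc (snd u) c) | c. norm c \<le> 1}"
      using e by (intro CollectI exI[of _ e]) auto
  next
    fix r assume "r \<in> {norm (fst u * c + sc (snd u) c) | c. norm c \<le> 1}"
    then obtain c where c: "norm c \<le> 1" "r = norm (fst u * c + sc (snd u) c)" by auto
    have "fst u * c + sc (snd u) c = (fst u + sc (snd u) e) * c"
      by (simp add: algebra_simps sc_mult_left e)
    then have "r \<le> norm (fst u + sc (snd u) e) * norm c"
      unfolding c(2) by (simp add: norm_mult_ineq)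
    also have "\<dots> \<le> norm (fst u + sc (snd u) e)" using c(1) by (simp add: mult_left_le)
    finally show "r \<le> norm (fst u + sc (snd u) e)" .
  qed
  finally show ?thesis .
qed (simp add: u1_norm_def)

lemma N_upper: "norm c \<le> 1 \<Longrightarrow> norm (fst u * c + sc (snd u) c) \<le> N u"
  unfolding N_eq_Sup by (rule cSup_upper[OF _ action_bdd]) auto

lemma N_least: "(\<And>c. norm c \<le> 1 \<Longrightarrow> norm (fst u * c + sc (snd u) c) \<le> K) \<Longrightarrow> N u \<le> K"
  unfolding N_eq_Sup by (rule cSup_least) (auto intro: exI[of _ 0])

lemma N_nonneg: "0 \<le> N u"
  using N_upper[of 0 u] by (simp add: order_trans[OF norm_ge_zero])

lemma N_triangle: "N (u + v) \<le> N u + N v"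
proof (rule N_least)
  fix c :: 'a assume c: "norm c \<le> 1"
  have "fst (u + v) * c + sc (snd (u + v)) c =
      (fst u * c + sc (snd u) c) + (fst v * c + sc (snd v) c)"
    by (simp add: algebra_simps sc_add_left)
  then show "norm (fst (u + v) * c + sc (snd (u + v)) c) \<le> N u + N v"
    using N_upper[OF c, of u] N_upper[OF c, of v] by (metis add_mono norm_triangle_le)
qed

lemma N_scale_le: "N (u1_scale sc d u) \<le> cmod d * N u"
proof (rule N_least)
  fix c :: 'a assume c: "norm c \<le> 1"
  have "fst (u1_scale sc d u) * c + sc (snd (u1_scale sc d u)) c = sc d (fst u * c + sc (snd u) c)"
    by (simp add: u1_scale_def sc_mult_left sc_add_right sc_sc)
  then show "norm (fst (u1_scale sc d u) * c + sc (snd (u1_scale sc d u)) c) \<le> cmod d * N u"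
    using N_upper[OF c, of u] by (simp add: norm_sc mult_left_mono)
qed

lemma N_scaleR_le: "N (r *\<^sub>R u) \<le> \<bar>r\<bar> * N u"
  using N_scale_le[of "complex_of_real r" u] by (simp add: u1_scale_of_real)

lemma N_uminus: "N (- u) = N u"
  using N_scaleR_le[of "-1" u] N_scaleR_le[of "-1" "- u"] by simp

text \<open>Only an inequality, since \<open>N (0, 1)\<close> is 0 in the zero algebra.\<close>

lemma N_one: "N (0, 1) \<le> 1"
  by (rule N_least) (simp add: sc_one)

text \<open>The approximate identity enters here: \<open>norm (a * e)\<close> is at most
  \<open>N (a, 0)\<close> for \<open>e\<close> in the unit ball and tends to \<open>norm a\<close>
  along the filter.\<close>

lemma N_embed: "N (a, 0) = norm a"
proof (rule antisym)
  show "N (a, 0) \<le> norm a"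
    by (rule N_least) (use action_bound[of _ "(a, 0)"] in auto)
  obtain F :: "'a filter" where F: "F \<noteq> bot" "F \<le> principal {e. norm e \<le> 1}"
    "((\<lambda>e. a * e) \<longlongrightarrow> a) F"
    using approx_unital by (auto simp: approx_unital_def)
  have "((\<lambda>e. norm (a * e)) \<longlongrightarrow> norm a) F" using F(3) by (rule tendsto_norm)
  moreover have "eventually (\<lambda>e. norm (a * e) \<le> N (a, 0)) F"
    using filter_leD[OF F(2)] N_upper[of _ "(a, 0)"]
    by (auto simp: eventually_principal sc_zero_left)
  ultimately show "norm a \<le> N (a, 0)" using F(1) by (rule tendsto_upperbound)
qed

section \<open>The dual space and its norm\<close>

abbreviation "D \<equiv> u1_dual sc"
abbreviation "dn \<equiv> dual_norm sc"

lemma D_add: "\<phi> \<in> D \<Longrightarrow> \<phi> (u + v) = \<phi> u + \<phi> v"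
  and D_scale: "\<phi> \<in> D \<Longrightarrow> \<phi> (u1_scale sc c u) = c * \<phi> u"
  unfolding u1_dual_def by blast+

lemma D_scaleR: "\<phi> \<in> D \<Longrightarrow> \<phi> (r *\<^sub>R u) = complex_of_real r * \<phi> u"
  using D_scale[of \<phi> "complex_of_real r" u] by (simp add: u1_scale_of_real)

lemma D_bounded:
  assumes "\<phi> \<in> D"
  obtains K where "K \<ge> 0" "\<And>u. cmod (\<phi> u) \<le> K * N u"
proof -
  obtain K where "\<And>u. cmod (\<phi> u) \<le> K * N u" using assms unfolding u1_dual_def by blast
  moreover have "K * N u \<le> \<bar>K\<bar> * N u" for u using N_nonneg by (intro mult_right_mono) auto
  ultimately show ?thesis using that[of "\<bar>K\<bar>"] by (meson abs_ge_zero order_trans)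
qed

lemma dual_norm_upper:
  assumes "\<phi> \<in> D" "N u \<le> 1"
  shows "cmod (\<phi> u) \<le> dn \<phi>"
proof -
  obtain K where K: "K \<ge> 0" "\<And>u. cmod (\<phi> u) \<le> K * N u" using D_bounded[OF assms(1)] by blast
  have "cmod (\<phi> v) \<le> K" if "N v \<le> 1" for v
    using K(2)[of v] mult_left_le[OF that K(1)] by linarith
  then have "bdd_above {cmod (\<phi> u) | u. N u \<le> 1}" by (auto intro!: bdd_aboveI)
  then show ?thesis unfolding dual_norm_def using assms(2) by (intro cSup_upper) blast
qed

lemma dual_norm_nonneg: "\<phi> \<in> D \<Longrightarrow> 0 \<le> dn \<phi>"
  using dual_norm_upper[of \<phi> 0] N_scaleR_le[of 0 0] by (simp add: order_trans[OF norm_ge_zero])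

lemma dual_norm_least: "(\<And>u. N u \<le> 1 \<Longrightarrow> cmod (\<phi> u) \<le> K) \<Longrightarrow> dn \<phi> \<le> K"
  unfolding dual_norm_def
proof (rule cSup_least)
  have "N 0 \<le> 1" using N_scaleR_le[of 0 0] by simp
  then show "{cmod (\<phi> u) | u. N u \<le> 1} \<noteq> {}" by blast
qed blast

lemma dual_norm_bound:
  assumes "\<phi> \<in> D"
  shows "cmod (\<phi> u) \<le> dn \<phi> * N u"
\<comment> \<open>\<open>N\<close> is only a seminorm on pairs: for a unit \<open>e\<close>, the
  pair \<open>(- e, 1)\<close> represents zero. Boundedness with some constant settles the
  degenerate case.\<close>
proof (cases "N u = 0")
  case True
  then show ?thesis using D_bounded[OF assms] by (metis mult_zero_right)
next
  case False
  then have pos: "N u > 0" using N_nonneg[of u] by simp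
  have "N (inverse (N u) *\<^sub>R u) \<le> 1" using N_scaleR_le[of "inverse (N u)" u] pos by simp
  then have "cmod (\<phi> (inverse (N u) *\<^sub>R u)) \<le> dn \<phi>" by (rule dual_norm_upper[OF assms])
  then show ?thesis
    using pos by (simp add: D_scaleR[OF assms] norm_mult norm_divide divide_simps mult.commute)
qed

lemma D_plus:
  assumes "\<phi> \<in> D" "\<psi> \<in> D"
  shows "(\<lambda>u. \<phi> u + \<psi> u) \<in> D"
proof -
  have "cmod (\<phi> u + \<psi> u) \<le> (dn \<phi> + dn \<psi>) * N u" for u
    using dual_norm_bound[OF assms(1), of u] dual_norm_bound[OF assms(2), of u]
      norm_triangle_ineq[of "\<phi> u" "\<psi> u"]
    by (simp add: distrib_right)
  moreover have "\<phi> (u + v) + \<psi> (u + v) = (\<phi> u + \<psi> u) + (\<phi> v + \<psi> v)" for u v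
    by (simp add: D_add assms)
  moreover have "\<phi> (u1_scale sc c u) + \<psi> (u1_scale sc c u) = c * (\<phi> u + \<psi> u)" for c u
    by (simp add: D_scale assms distrib_left)
  ultimately show ?thesis unfolding u1_dual_def by blast
qed

lemma D_times:
  assumes "\<phi> \<in> D"
  shows "(\<lambda>u. c * \<phi> u) \<in> D"
proof -
  have "cmod (c * \<phi> u) \<le> (cmod c * dn \<phi>) * N u" for u
    using mult_left_mono[OF dual_norm_bound[OF assms, of u], of "cmod c"]
    by (simp add: norm_mult mult.assoc)
  moreover have "c * \<phi> (u + v) = c * \<phi> u + c * \<phi> v" for u v
    by (simp add: D_add assms distrib_left)
  moreover have "c * \<phi> (u1_scale sc d u) = d * (c * \<phi> u)" for d u
    by (simp add: D_scale assms)
  ultimately show ?thesis unfolding u1_dual_def by blast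
qed

text \<open>A real-linear \<open>f\<close> is the real part of the complex-linear map
  \<open>u \<mapsto> f u - \<i> f (\<i> u)\<close>. The crude constant \<open>2 * K\<close> is
  enough for membership in the dual; sharp norm estimates are obtained later by rotation.\<close>

lemma complexify_in_D:
  fixes f :: "'a \<times> complex \<Rightarrow> real"
  assumes lin: "linear f" and le: "\<And>u. f u \<le> K * N u"
  shows "(\<lambda>u. Complex (f u) (- f (u1_scale sc \<i> u))) \<in> D"
proof -
  let ?g = "\<lambda>u. Complex (f u) (- f (u1_scale sc \<i> u))"
  have ab: "\<bar>f u\<bar> \<le> K * N u" for u
    using le[of u] le[of "- u"] by (simp add: linear_neg[OF lin] N_uminus)
  \<comment> \<open>Multiplication by \<i> preserves \<open>N\<close>, because scaling by
    \<open>-\<i>\<close> undoes it.\<close>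
  have "f (u1_scale sc \<i> u) \<le> K * N u" "- f (u1_scale sc \<i> u) \<le> K * N u" for u
  proof -
    have "N (u1_scale sc (-\<i>) (u1_scale sc \<i> u)) \<le> N (u1_scale sc \<i> u)"
      using N_scale_le[of "-\<i>" "u1_scale sc \<i> u"] by simp
    moreover have "u1_scale sc (-\<i>) (u1_scale sc \<i> u) = u"
      by (simp add: u1_scale_scale u1_scale_one)
    moreover have "N (u1_scale sc \<i> u) \<le> N u" using N_scale_le[of \<i> u] by simp
    ultimately have "N (u1_scale sc \<i> u) = N u" by simp
    then show "f (u1_scale sc \<i> u) \<le> K * N u" "- f (u1_scale sc \<i> u) \<le> K * N u"
      using ab[of "u1_scale sc \<i> u"] by auto
  qed
  then have im: "\<bar>f (u1_scale sc \<i> u)\<bar> \<le> K * N u" for u by (rule abs_leI)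
  have bound: "cmod (?g u) \<le> (2 * K) * N u" for u
    using cmod_le[of "?g u"] ab[of u] im[of u] by simp
  have scale: "?g (u1_scale sc c u) = c * ?g u" for c u
  proof -
    have 1: "u1_scale sc c v = Re c *\<^sub>R v + Im c *\<^sub>R u1_scale sc \<i> v" for c v
    proof -
      have "u1_scale sc c v = u1_scale sc (complex_of_real (Re c) + complex_of_real (Im c) * \<i>) v"
        by (rule arg_cong[where f = "\<lambda>c. u1_scale sc c v"]) (simp add: complex_eq_iff)
      then show ?thesis
        by (simp only: u1_scale_add_left u1_scale_scale[symmetric] u1_scale_of_real)
    qed
    have "f (u1_scale sc c v) = Re c * f v + Im c * f (u1_scale sc \<i> v)" for c v
      by (subst 1) (simp add: linear_add[OF lin] linear_cmul[OF lin])
    from this[of c u] this[of "\<i> * c" u] show ?thesis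
      by (simp add: u1_scale_scale complex_eq_iff)
  qed
  have add: "?g (u + v) = ?g u + ?g v" for u v
    by (simp add: u1_scale_add_right linear_add[OF lin] complex_eq_iff)
  show ?thesis unfolding u1_dual_def using add scale bound by blast
qed


text \<open>Multiplying \<open>u\<close> by the conjugate phase of \<open>\<phi> u\<close> turns the
  modulus into a real part. As \<open>sgn 0 = 0\<close>, the multiplier has modulus at most 1 even
  where \<open>\<phi> u\<close> vanishes.\<close>

lemma D_rotate:
  assumes "\<phi> \<in> D"
  obtains v where "N v \<le> N u" "Re (\<phi> v) = cmod (\<phi> u)"
proof
  let ?c = "cnj (sgn (\<phi> u))"
  have "N (u1_scale sc ?c u) \<le> cmod ?c * N u" by (rule N_scale_le)
  also have "\<dots> \<le> 1 * N u" using N_nonneg by (intro mult_right_mono) (auto simp: norm_sgn)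
  finally show "N (u1_scale sc ?c u) \<le> N u" by simp
  have "\<phi> (u1_scale sc ?c u) = cnj (sgn (\<phi> u)) * \<phi> u" by (rule D_scale[OF assms])
  also have "\<dots> = complex_of_real (cmod (\<phi> u))"
  proof (cases "\<phi> u = 0")
    case False
    have "cnj (\<phi> u) * \<phi> u = complex_of_real ((cmod (\<phi> u))\<^sup>2)"
      by (simp add: complex_norm_square[symmetric] mult.commute)
    with False show ?thesis
      by (simp add: sgn_div_norm scaleR_conv_of_real power2_eq_square field_simps)
  qed simp
  finally show "Re (\<phi> (u1_scale sc ?c u)) = cmod (\<phi> u)" by simp
qed

section \<open>The bidual and its norm\<close>

abbreviation "B \<equiv> u1_bidual sc"
abbreviation "bn \<equiv> bidual_norm sc"

lemma B_add: "\<eta> \<in> B \<Longrightarrow> \<phi> \<in> D \<Longrightarrow> \<psi> \<in> D \<Longrightarrow> \<eta> (\<lambda>u. \<phi> u + \<psi> u) = \<eta> \<phi> + \<eta> \<psi>"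
  and B_scale: "\<eta> \<in> B \<Longrightarrow> \<phi> \<in> D \<Longrightarrow> \<eta> (\<lambda>u. c * \<phi> u) = c * \<eta> \<phi>"
  unfolding u1_bidual_def by blast+

lemma B_bounded:
  assumes "\<eta> \<in> B"
  obtains K where "K \<ge> 0" "\<And>\<phi>. \<phi> \<in> D \<Longrightarrow> cmod (\<eta> \<phi>) \<le> K * dn \<phi>"
proof -
  obtain K where K: "\<And>\<phi>. \<phi> \<in> D \<Longrightarrow> cmod (\<eta> \<phi>) \<le> K * dn \<phi>"
    using assms unfolding u1_bidual_def by blast
  show ?thesis
  proof (rule that[of "\<bar>K\<bar>"])
    fix \<phi> assume "\<phi> \<in> D"
    then have "K * dn \<phi> \<le> \<bar>K\<bar> * dn \<phi>" by (intro mult_right_mono dual_norm_nonneg) auto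
    then show "cmod (\<eta> \<phi>) \<le> \<bar>K\<bar> * dn \<phi>" using K[OF \<open>\<phi> \<in> D\<close>] by linarith
  qed simp
qed

lemma dual_norm_times_le:
  assumes "\<phi> \<in> D"
  shows "dn (\<lambda>u. c * \<phi> u) \<le> cmod c * dn \<phi>"
  by (rule dual_norm_least)
    (simp add: norm_mult mult_left_mono dual_norm_upper[OF assms])

lemma D_null: "(\<lambda>u. 0) \<in> D"
  unfolding u1_dual_def by (auto intro: exI[of _ 0])

lemma dual_norm_null: "dn (\<lambda>u. 0) \<le> 0"
  by (rule dual_norm_least) simp

lemma bidual_norm_least:
  "(\<And>\<phi>. \<phi> \<in> D \<Longrightarrow> dn \<phi> \<le> 1 \<Longrightarrow> cmod (\<eta> \<phi>) \<le> K) \<Longrightarrow> bn \<eta> \<le> K"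
  unfolding bidual_norm_def
proof (rule cSup_least)
  have "dn (\<lambda>u. 0) \<le> 1" using dual_norm_null by simp
  with D_null show "{cmod (\<eta> \<phi>) | \<phi>. \<phi> \<in> D \<and> dn \<phi> \<le> 1} \<noteq> {}" by blast
qed blast

lemma bidual_norm_upper:
  assumes "\<eta> \<in> B" "\<phi> \<in> D" "dn \<phi> \<le> 1"
  shows "cmod (\<eta> \<phi>) \<le> bn \<eta>"
proof -
  obtain K where K: "K \<ge> 0" "\<And>\<phi>. \<phi> \<in> D \<Longrightarrow> cmod (\<eta> \<phi>) \<le> K * dn \<phi>"
    using B_bounded[OF assms(1)] by blast
  have "cmod (\<eta> \<psi>) \<le> K" if "\<psi> \<in> D" "dn \<psi> \<le> 1" for \<psi>
    using K(2)[OF that(1)] mult_left_le[OF that(2) K(1)] by linarith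
  then have "bdd_above {cmod (\<eta> \<phi>) | \<phi>. \<phi> \<in> D \<and> dn \<phi> \<le> 1}" by (auto intro!: bdd_aboveI)
  then show ?thesis unfolding bidual_norm_def using assms(2,3) by (intro cSup_upper) blast
qed

lemma bidual_norm_bound:
  assumes "\<eta> \<in> B" "\<phi> \<in> D"
  shows "cmod (\<eta> \<phi>) \<le> bn \<eta> * dn \<phi>"
proof (cases "dn \<phi> = 0")
  case True
  then show ?thesis using B_bounded[OF assms(1)] assms(2) by (metis mult_zero_right)
next
  case False
  let ?r = "dn \<phi>"
  have pos: "?r > 0" using False dual_norm_nonneg[OF assms(2)] by simp
  have "dn (\<lambda>u. complex_of_real (1 / ?r) * \<phi> u) \<le> 1"
    using dual_norm_times_le[OF assms(2), of "complex_of_real (1 / ?r)"] pos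
    by (simp add: norm_divide)
  then have "cmod (\<eta> (\<lambda>u. complex_of_real (1 / ?r) * \<phi> u)) \<le> bn \<eta>"
    by (intro bidual_norm_upper assms D_times)
  then show ?thesis
    unfolding B_scale[OF assms]
    using pos by (simp add: norm_mult norm_divide divide_simps mult.commute)
qed

lemma B_plus:
  assumes "\<eta> \<in> B" "\<zeta> \<in> B"
  shows "(\<lambda>\<phi>. \<eta> \<phi> + \<zeta> \<phi>) \<in> B"
proof -
  have "cmod (\<eta> \<phi> + \<zeta> \<phi>) \<le> (bn \<eta> + bn \<zeta>) * dn \<phi>" if "\<phi> \<in> D" for \<phi>
    using bidual_norm_bound[OF assms(1) that] bidual_norm_bound[OF assms(2) that]
      norm_triangle_ineq[of "\<eta> \<phi>" "\<zeta> \<phi>"]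
    by (simp add: distrib_right)
  then show ?thesis
    using assms by (auto simp: u1_bidual_def distrib_left)
qed

lemma B_times:
  assumes "\<eta> \<in> B"
  shows "(\<lambda>\<phi>. c * \<eta> \<phi>) \<in> B"
proof -
  have "cmod (c * \<eta> \<phi>) \<le> (cmod c * bn \<eta>) * dn \<phi>" if "\<phi> \<in> D" for \<phi>
    using mult_left_mono[OF bidual_norm_bound[OF assms that], of "cmod c"]
    by (simp add: norm_mult mult.assoc)
  then show ?thesis
    using assms by (auto simp: u1_bidual_def distrib_left)
qed

lemma B_eval: "(\<lambda>\<phi>. \<phi> u) \<in> B"
  using dual_norm_bound[of _ u] by (auto simp: u1_bidual_def mult.commute intro!: exI[of _ "N u"])

lemma bidual_norm_eval: "bn (\<lambda>\<phi>. \<phi> u) \<le> N u"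
proof (rule bidual_norm_least)
  fix \<phi> assume "\<phi> \<in> D" "dn \<phi> \<le> 1"
  then show "cmod (\<phi> u) \<le> N u"
    using dual_norm_bound[of \<phi> u] mult_right_mono[of "dn \<phi>" 1 "N u"] N_nonneg[of u] by simp
qed

text \<open>Elements of the bidual are functions on all maps, but only their values on
  \<open>D\<close> carry meaning.\<close>

lemma bidual_norm_cong: "(\<And>\<phi>. \<phi> \<in> D \<Longrightarrow> \<eta> \<phi> = \<zeta> \<phi>) \<Longrightarrow> bn \<eta> = bn \<zeta>"
  unfolding bidual_norm_def by (rule arg_cong[where f = Sup]) force

section \<open>The projection of the unit\<close>

text \<open>With \<open>p = P 1\<close>, the first bound is contractivity of \<open>P\<close> at
  \<open>1 + w\<close>, where \<open>P (1 + w) = p + w\<close>. For the second,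
  \<open>\<theta> = 1 + w - t p\<close> has \<open>P \<theta> = (1 - t) p + w\<close> and
  \<open>\<theta> - P \<theta> = 1 - p\<close>; the latter has norm at most 1, so the maximum
  formula bounds \<open>\<theta>\<close> as soon as \<open>P \<theta>\<close> is in the unit
  ball.\<close>

lemma M_ideal_unit_projection:
  assumes "M_ideal_in_u1 sc"
  obtains p where "p \<in> annih2 sc"
    "\<And>w \<phi>. \<phi> \<in> D \<Longrightarrow> cmod (p \<phi> + \<phi> (w, 0)) \<le> N (w, 1) * dn \<phi>"
    "\<And>w t \<phi>. \<phi> \<in> D \<Longrightarrow>
       (\<And>\<psi>. \<psi> \<in> D \<Longrightarrow> cmod ((1 - t) * p \<psi> + \<psi> (w, 0)) \<le> dn \<psi>) \<Longrightarrow>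
       cmod (\<phi> (w, 1) - t * p \<phi>) \<le> dn \<phi>"
proof -
  obtain P where P_ann: "\<And>\<eta>. \<eta> \<in> B \<Longrightarrow> P \<eta> \<in> annih2 sc"
    and P_onto: "\<And>\<zeta>. \<zeta> \<in> annih2 sc \<Longrightarrow> \<exists>\<eta>\<in>B. \<forall>\<phi>\<in>D. P \<eta> \<phi> = \<zeta> \<phi>"
    and P_idem: "\<And>\<eta> \<phi>. \<eta> \<in> B \<Longrightarrow> \<phi> \<in> D \<Longrightarrow> P (P \<eta>) \<phi> = P \<eta> \<phi>"
    and P_add: "\<And>\<eta> \<zeta> \<phi>. \<eta> \<in> B \<Longrightarrow> \<zeta> \<in> B \<Longrightarrow> \<phi> \<in> D \<Longrightarrow>
      P (\<lambda>\<psi>. \<eta> \<psi> + \<zeta> \<psi>) \<phi> = P \<eta> \<phi> + P \<zeta> \<phi>"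
    and P_scale: "\<And>\<eta> c \<phi>. \<eta> \<in> B \<Longrightarrow> \<phi> \<in> D \<Longrightarrow> P (\<lambda>\<psi>. c * \<eta> \<psi>) \<phi> = c * P \<eta> \<phi>"
    and P_norm: "\<And>\<eta>. \<eta> \<in> B \<Longrightarrow> bn \<eta> = max (bn (P \<eta>)) (bn (\<lambda>\<psi>. \<eta> \<psi> - P \<eta> \<psi>))"
    using assms unfolding M_ideal_in_u1_def by (elim exE conjE) (rule that; simp)
  have P_B: "P \<eta> \<in> B" if "\<eta> \<in> B" for \<eta>
    using P_ann[OF that] by (simp add: annih2_def)
  \<comment> \<open>\<open>P\<close> acts on raw functions, so that it respects agreement on
    \<open>D\<close> has to be derived: the difference has norm at most 0, and \<open>P\<close> is
    contractive.\<close>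
  have P_cong: "P \<eta> \<phi> = P \<zeta> \<phi>"
    if "\<eta> \<in> B" "\<zeta> \<in> B" "\<And>\<psi>. \<psi> \<in> D \<Longrightarrow> \<eta> \<psi> = \<zeta> \<psi>" "\<phi> \<in> D" for \<eta> \<zeta> \<phi>
  proof -
    let ?d = "\<lambda>\<psi>. \<eta> \<psi> + (-1) * \<zeta> \<psi>"
    have d: "?d \<in> B" using that by (intro B_plus B_times)
    have "bn (P ?d) \<le> bn ?d" using P_norm[OF d] by linarith
    also have "bn ?d \<le> 0" using that(3) by (intro bidual_norm_least) simp
    finally have "bn (P ?d) * dn \<phi> \<le> 0"
      using dual_norm_nonneg[OF that(4)] by (simp add: mult_nonpos_nonneg)
    with bidual_norm_bound[OF P_B[OF d] that(4)] have "cmod (P ?d \<phi>) \<le> 0" by (rule order_trans)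
    then have "P ?d \<phi> = 0" by simp
    moreover have "P ?d \<phi> = P \<eta> \<phi> + (-1) * P \<zeta> \<phi>"
      using that P_add[OF that(1) B_times[OF that(2)], of \<phi> "-1"] P_scale[OF that(2), of \<phi> "-1"]
      by simp
    ultimately show ?thesis by simp
  qed
  \<comment> \<open>Vectors of \<open>A\<close> lie in the bipolar, hence are of the form
    \<open>P \<eta>\<close> on \<open>D\<close>, and idempotence fixes them.\<close>
  have P_A: "P (\<lambda>\<psi>. \<psi> (w, 0)) \<phi> = \<phi> (w, 0)" if "\<phi> \<in> D" for w \<phi>
  proof -
    have "(\<lambda>\<psi>. \<psi> (w, 0)) \<in> annih2 sc" using B_eval by (auto simp: annih2_def)
    then obtain \<eta> where \<eta>: "\<eta> \<in> B" "\<And>\<phi>. \<phi> \<in> D \<Longrightarrow> P \<eta> \<phi> = \<phi> (w, 0)"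
      using P_onto by blast
    have "P (\<lambda>\<psi>. \<psi> (w, 0)) \<phi> = P (P \<eta>) \<phi>"
      using \<eta> that by (intro P_cong B_eval P_B) auto
    then show ?thesis using P_idem[OF \<eta>(1) that] \<eta>(2)[OF that] by simp
  qed
  define p where "p = P (\<lambda>\<psi>. \<psi> (0, 1))"
  have p: "p \<in> annih2 sc" unfolding p_def by (rule P_ann[OF B_eval])
  then have pB: "p \<in> B" by (simp add: annih2_def)
  let ?e = "\<lambda>w \<psi>. \<psi> (0, 1) + \<psi> (w, 0)"
  have eB: "?e w \<in> B" for w by (intro B_plus B_eval)
  have ev: "\<psi> (w, 1) = ?e w \<psi>" if "\<psi> \<in> D" for \<psi> w
    using D_add[OF that, of "(0, 1)" "(w, 0)"] by simp
  have Pe: "P (?e w) \<phi> = p \<phi> + \<phi> (w, 0)" if "\<phi> \<in> D" for w \<phi>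
    using P_add[OF B_eval B_eval that] P_A[OF that] by (simp add: p_def)
  have one: "bn (\<lambda>\<psi>. \<psi> (0, 1) - p \<psi>) \<le> 1"
    using P_norm[OF B_eval, of "(0, 1)"] bidual_norm_eval[of "(0, 1)"] N_one
    unfolding p_def by linarith
  show ?thesis
  proof (rule that[OF p])
    fix w \<phi> assume \<phi>: "\<phi> \<in> D"
    have "bn (P (?e w)) \<le> bn (?e w)" using P_norm[OF eB] by (simp add: max.coboundedI1)
    also have "\<dots> = bn (\<lambda>\<psi>. \<psi> (w, 1))" by (rule bidual_norm_cong) (rule ev[symmetric])
    also have "\<dots> \<le> N (w, 1)" by (rule bidual_norm_eval)
    finally have "bn (P (?e w)) * dn \<phi> \<le> N (w, 1) * dn \<phi>"
      by (intro mult_right_mono dual_norm_nonneg \<phi>)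
    then show "cmod (p \<phi> + \<phi> (w, 0)) \<le> N (w, 1) * dn \<phi>"
      using bidual_norm_bound[OF P_B[OF eB] \<phi>, of w] by (simp add: Pe[OF \<phi>])
  next
    fix w t \<phi>
    assume \<phi>: "\<phi> \<in> D"
      and bound: "\<And>\<psi>. \<psi> \<in> D \<Longrightarrow> cmod ((1 - t) * p \<psi> + \<psi> (w, 0)) \<le> dn \<psi>"
    let ?\<theta> = "\<lambda>\<psi>. ?e w \<psi> + (- t) * p \<psi>"
    have \<theta>: "?\<theta> \<in> B" by (intro B_plus[OF eB] B_times pB)
    have P\<theta>: "P ?\<theta> \<psi> = (1 - t) * p \<psi> + \<psi> (w, 0)" if "\<psi> \<in> D" for \<psi>
    proof -
      have "P p \<psi> = p \<psi>" unfolding p_def by (rule P_idem[OF B_eval that])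
      then show ?thesis
        using P_add[OF eB[of w] B_times[OF pB] that, of "- t"] P_scale[OF pB that, of "- t"] Pe[OF that]
        by (simp add: algebra_simps)
    qed
    have "bn (P ?\<theta>) \<le> 1"
    proof (rule bidual_norm_least)
      fix \<psi> assume \<psi>: "\<psi> \<in> D" "dn \<psi> \<le> 1"
      show "cmod (P ?\<theta> \<psi>) \<le> 1"
        unfolding P\<theta>[OF \<psi>(1)] using bound[OF \<psi>(1)] \<psi>(2) by linarith
    qed
    moreover have "bn (\<lambda>\<psi>. ?\<theta> \<psi> - P ?\<theta> \<psi>) = bn (\<lambda>\<psi>. \<psi> (0, 1) - p \<psi>)"
      by (rule bidual_norm_cong) (simp only: P\<theta>, simp add: algebra_simps)
    ultimately have "bn ?\<theta> \<le> 1" using P_norm[OF \<theta>] one by simp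
    then have "bn ?\<theta> * dn \<phi> \<le> 1 * dn \<phi>" by (intro mult_right_mono dual_norm_nonneg \<phi>)
    then show "cmod (\<phi> (w, 1) - t * p \<phi>) \<le> dn \<phi>"
      using bidual_norm_bound[OF \<theta> \<phi>] by (simp add: ev[OF \<phi>, of w])
  qed
qed

section \<open>Intersection of balls\<close>

text \<open>If \<open>A\<close> missed the enlarged balls, the quotient of the weighted maximum norm on
  \<open>A\<^sup>1 \<times> A\<^sup>1 \<times> A\<^sup>1\<close> by the diagonal copy of \<open>A\<close> would be at least 1 at the triple of centres.
  A functional attaining it splits into three functionals whose sum annihilates \<open>A\<close>, hence
  also \<open>z\<close>, which contradicts the bounds on \<open>y\<^sub>i - z\<close>.\<close>

lemma three_balls_meet_A:
  fixes y1 y2 y3 :: "'a \<times> complex"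
  assumes z: "z \<in> annih2 sc"
    and r: "0 \<le> r1" "r1 < R1" "0 \<le> r2" "r2 < R2" "0 \<le> r3" "r3 < R3"
    and y1: "\<And>\<phi>. \<phi> \<in> D \<Longrightarrow> cmod (\<phi> y1 - z \<phi>) \<le> r1 * dn \<phi>"
    and y2: "\<And>\<phi>. \<phi> \<in> D \<Longrightarrow> cmod (\<phi> y2 - z \<phi>) \<le> r2 * dn \<phi>"
    and y3: "\<And>\<phi>. \<phi> \<in> D \<Longrightarrow> cmod (\<phi> y3 - z \<phi>) \<le> r3 * dn \<phi>"
  shows "\<exists>a. N (y1 - (a, 0)) \<le> R1 \<and> N (y2 - (a, 0)) \<le> R2 \<and> N (y3 - (a, 0)) \<le> R3"
proof (rule ccontr)
  assume none: "\<not> ?thesis"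
  have R: "R1 > 0" "R2 > 0" "R3 > 0" using r by auto
  \<comment> \<open>\<open>m u \<le> 1\<close> says that the three components of \<open>u\<close>
    lie in the balls of radii \<open>R1\<close>, \<open>R2\<close>, \<open>R3\<close>.\<close>
  define m where "m u = max (N (fst u) / R1) (max (N (fst (snd u)) / R2) (N (snd (snd u)) / R3))"
    for u :: "('a \<times> complex) \<times> ('a \<times> complex) \<times> ('a \<times> complex)"
  define \<iota> :: "'a \<Rightarrow> ('a \<times> complex) \<times> ('a \<times> complex) \<times> ('a \<times> complex)"
    where "\<iota> a = ((a, 0), (a, 0), (a, 0))" for a
  have m_le: "m (u, v, w) \<le> c" if "N u \<le> c * R1" "N v \<le> c * R2" "N w \<le> c * R3" for u v w c
    using that R by (simp add: m_def pos_divide_le_eq)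
  have m_ge: "N (fst u) \<le> m u * R1" "N (fst (snd u)) \<le> m u * R2" "N (snd (snd u)) \<le> m u * R3" for u
    using R unfolding m_def by (simp_all flip: pos_divide_le_eq)
  have m0: "0 \<le> m u" for u
    using N_nonneg[of "fst u"] R by (simp add: m_def le_max_iff_disj)
  have N0: "N 0 = 0" using N_embed[of 0] by (simp add: zero_prod_def)
  have m_sub: "sublinear m"
    unfolding sublinear_def
  proof (intro conjI allI impI)
    fix u v
    have "m (fst u + fst v, fst (snd u) + fst (snd v), snd (snd u) + snd (snd v)) \<le> m u + m v"
      using m_ge[of u] m_ge[of v] N_triangle[of "fst u" "fst v"]
        N_triangle[of "fst (snd u)" "fst (snd v)"] N_triangle[of "snd (snd u)" "snd (snd v)"]
      by (intro m_le; subst distrib_right; linarith)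
    then show "m (u + v) \<le> m u + m v" by (simp add: plus_prod_def)
  next
    fix t :: real and u assume t: "t > 0"
    have "N (t *\<^sub>R v) \<le> t * m u * K" if "N v \<le> m u * K" for v K
    proof -
      have "t * N v \<le> t * (m u * K)" using that t by (intro mult_left_mono) auto
      moreover have "N (t *\<^sub>R v) \<le> t * N v" using N_scaleR_le[of t v] t by simp
      ultimately show ?thesis unfolding mult.assoc by linarith
    qed
    then have "m (t *\<^sub>R fst u, t *\<^sub>R fst (snd u), t *\<^sub>R snd (snd u)) \<le> t * m u"
      using m_ge[of u] by (intro m_le) auto
    then show "m (t *\<^sub>R u) \<le> t * m u" by (simp add: scaleR_prod_def)
  qed
  have \<iota>_lin: "linear \<iota>" by (rule linearI) (auto simp: \<iota>_def)
  let ?q = "\<lambda>u. INF a. m (u - \<iota> a)"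
  note q = sublinear_quotient[OF m_sub m0 \<iota>_lin]
  obtain f where f: "linear f" "\<And>u. f u \<le> ?q u" "f (y1, y2, y3) = ?q (y1, y2, y3)"
    using Hahn_Banach_sublinear[OF q(1)] by blast
  have "1 \<le> ?q (y1, y2, y3)"
  proof (rule cINF_greatest)
    fix a
    show "1 \<le> m ((y1, y2, y3) - \<iota> a)"
    proof (rule ccontr)
      let ?d = "(y1, y2, y3) - \<iota> a"
      assume "\<not> 1 \<le> m ?d"
      then have "m ?d * K \<le> K" if "K > 0" for K using that by simp
      then have "N (fst ?d) \<le> R1" "N (fst (snd ?d)) \<le> R2" "N (snd (snd ?d)) \<le> R3"
        using m_ge[of ?d] R by (meson order_trans)+
      then show False using none by (auto simp: \<iota>_def)
    qed
  qed simp
  then have fy: "1 \<le> f (y1, y2, y3)" using f(3) by simp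
  have fm: "f u \<le> m u" for u
    using f(2)[of u] q(2)[of u 0] linear_0[OF \<iota>_lin] by simp
  \<comment> \<open>Taking \<open>a\<close> itself as representative bounds the quotient value by
    \<open>m 0 = 0\<close>; applying this to \<open>- a\<close> as well gives equality.\<close>
  have "f (\<iota> a) \<le> 0" for a
    using f(2)[of "\<iota> a"] q(2)[of "\<iota> a" a] m_le[of 0 0 0 0] by (simp add: N_embed zero_prod_def)
  from this[of a for a] this[of "- a" for a] have f\<iota>: "f (\<iota> a) = 0" for a
    by (simp add: linear_neg[OF \<iota>_lin] linear_neg[OF f(1)] antisym)
  let ?f1 = "\<lambda>u. f (u, 0, 0)" and ?f2 = "\<lambda>u. f (0, u, 0)" and ?f3 = "\<lambda>u. f (0, 0, u)"
  have f_split: "f (u, v, w) = ?f1 u + ?f2 v + ?f3 w" for u v w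
    by (simp flip: linear_add[OF f(1)])
  have lin: "linear ?f1" "linear ?f2" "linear ?f3"
    by (rule linear_compose[OF _ f(1), unfolded o_def], rule linearI; simp)+
  define g1 where "g1 u = Complex (?f1 u) (- ?f1 (u1_scale sc \<i> u))" for u
  define g2 where "g2 u = Complex (?f2 u) (- ?f2 (u1_scale sc \<i> u))" for u
  define g3 where "g3 u = Complex (?f3 u) (- ?f3 (u1_scale sc \<i> u))" for u
  have b: "?f1 u \<le> (1 / R1) * N u" "?f2 u \<le> (1 / R2) * N u" "?f3 u \<le> (1 / R3) * N u" for u
    by (rule order_trans[OF fm m_le]; use R N_nonneg[of u] in \<open>simp add: N0\<close>)+
  have g: "g1 \<in> D" "g2 \<in> D" "g3 \<in> D"
    unfolding g1_def[abs_def] g2_def[abs_def] g3_def[abs_def]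
    using lin b by (intro complexify_in_D; blast)+
  \<comment> \<open>The norm dual to the weighted maximum is the weighted sum: \<open>f\<close> is
    tested on rotated vectors scaled by the radii, a triple on which \<open>m\<close> is at most
    1.\<close>
  have sum_le: "R1 * cmod (g1 u) + R2 * cmod (g2 v) + R3 * cmod (g3 w) \<le> 1"
    if "N u \<le> 1" "N v \<le> 1" "N w \<le> 1" for u v w
  proof -
    obtain u' where u': "N u' \<le> N u" "Re (g1 u') = cmod (g1 u)" by (rule D_rotate[OF g(1)])
    obtain v' where v': "N v' \<le> N v" "Re (g2 v') = cmod (g2 v)" by (rule D_rotate[OF g(2)])
    obtain w' where w': "N w' \<le> N w" "Re (g3 w') = cmod (g3 w)" by (rule D_rotate[OF g(3)])
    have s: "N (K *\<^sub>R x) \<le> 1 * K" if "N x \<le> N x'" "N x' \<le> 1" "K > 0" for K x x'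
    proof -
      have "K * N x \<le> K * 1" using that by (intro mult_left_mono) auto
      moreover have "N (K *\<^sub>R x) \<le> K * N x" using N_scaleR_le[of K x] that(3) by simp
      ultimately show ?thesis by linarith
    qed
    have "f (R1 *\<^sub>R u', R2 *\<^sub>R v', R3 *\<^sub>R w') \<le> 1"
      by (rule order_trans[OF fm m_le]) (rule s; use u' v' w' that R in blast)+
    then have "R1 * ?f1 u' + R2 * ?f2 v' + R3 * ?f3 w' \<le> 1"
      by (subst (asm) f_split)
        (simp only: linear_cmul[OF lin(1)] linear_cmul[OF lin(2)] linear_cmul[OF lin(3)] real_scaleR_def)
    then show ?thesis
      using u' v' w' by (simp add: g1_def g2_def g3_def)
  qed
  \<comment> \<open>The suprema are taken in one variable at a time while the others stay
    frozen.\<close>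
  have sum_le1: "R1 * dn g1 + R2 * cmod (g2 v) + R3 * cmod (g3 w) \<le> 1" if "N v \<le> 1" "N w \<le> 1" for v w
  proof -
    have "dn g1 \<le> (1 - R2 * cmod (g2 v) - R3 * cmod (g3 w)) / R1"
      using sum_le that R by (intro dual_norm_least) (simp add: field_simps)
    then show ?thesis using R by (simp add: field_simps)
  qed
  have "R1 * dn g1 + R2 * dn g2 + R3 * cmod (g3 w) \<le> 1" if "N w \<le> 1" for w
  proof -
    have "dn g2 \<le> (1 - R1 * dn g1 - R3 * cmod (g3 w)) / R2"
      using sum_le1 that R by (intro dual_norm_least) (simp add: field_simps)
    then show ?thesis using R by (simp add: field_simps)
  qed
  then have "dn g3 \<le> (1 - R1 * dn g1 - R2 * dn g2) / R3"
    using R by (intro dual_norm_least) (simp add: field_simps)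
  then have dn_sum: "R1 * dn g1 + R2 * dn g2 + R3 * dn g3 \<le> 1" using R by (simp add: field_simps)
  have zB: "z \<in> B" using z by (simp add: annih2_def)
  let ?S = "\<lambda>u. (g1 u + g2 u) + g3 u"
  \<comment> \<open>The imaginary part vanishes too, because \<open>f\<close> annihilates the
    diagonal copy of \<open>sc \<i> a\<close>.\<close>
  have "?S (a, 0) = 0" for a
  proof -
    have "?f1 (b, 0) + ?f2 (b, 0) + ?f3 (b, 0) = 0" for b
      using f\<iota>[of b] f_split[of "(b, 0)" "(b, 0)" "(b, 0)"] by (simp add: \<iota>_def)
    from this[of a] this[of "sc \<i> a"] show ?thesis
      by (simp add: g1_def g2_def g3_def u1_scale_def complex_eq_iff)
  qed
  then have "z ?S = 0" using z D_plus[OF D_plus[OF g(1,2)] g(3)] by (auto simp: annih2_def)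
  then have z0: "z g1 + z g2 + z g3 = 0"
    using B_add[OF zB D_plus[OF g(1,2)] g(3)] B_add[OF zB g(1,2)] by simp
  have "f (y1, y2, y3) = Re ((g1 y1 + g2 y2 + g3 y3) - (z g1 + z g2 + z g3))"
    unfolding z0 by (subst f_split) (simp add: g1_def g2_def g3_def)
  also have "\<dots> = Re (g1 y1 - z g1) + Re (g2 y2 - z g2) + Re (g3 y3 - z g3)" by simp
  also have "\<dots> \<le> r1 * dn g1 + r2 * dn g2 + r3 * dn g3"
    using y1[OF g(1)] y2[OF g(2)] y3[OF g(3)]
    by (intro add_mono) (meson complex_Re_le_cmod order_trans)+
  finally have "1 \<le> r1 * dn g1 + r2 * dn g2 + r3 * dn g3" using fy by linarith
  \<comment> \<open>If all three dual norms vanish the sum is 0; otherwise one of the strict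
    inequalities between radii makes it smaller than the weighted sum in
    \<open>dn_sum\<close>.\<close>
  moreover have "r1 * dn g1 + r2 * dn g2 + r3 * dn g3 < 1"
  proof -
    have le: "r1 * dn g1 \<le> R1 * dn g1" "r2 * dn g2 \<le> R2 * dn g2" "r3 * dn g3 \<le> R3 * dn g3"
      using r g by (auto intro!: mult_right_mono dual_norm_nonneg)
    have nn: "dn g1 \<ge> 0" "dn g2 \<ge> 0" "dn g3 \<ge> 0" using g dual_norm_nonneg by auto
    show ?thesis
    proof (cases "dn g1 = 0 \<and> dn g2 = 0 \<and> dn g3 = 0")
      case False
      then consider "dn g1 > 0" | "dn g2 > 0" | "dn g3 > 0" using nn by linarith
      then show ?thesis
      proof cases
        case 1
        then have "r1 * dn g1 < R1 * dn g1" using r by (simp add: mult_strict_right_mono)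
        then show ?thesis using le dn_sum by linarith
      next
        case 2
        then have "r2 * dn g2 < R2 * dn g2" using r by (simp add: mult_strict_right_mono)
        then show ?thesis using le dn_sum by linarith
      next
        case 3
        then have "r3 * dn g3 < R3 * dn g3" using r by (simp add: mult_strict_right_mono)
        then show ?thesis using le dn_sum by linarith
      qed
    qed simp
  qed
  ultimately show False by linarith
qed

text \<open>Moving from \<open>e\<close> towards the projection \<open>p\<close> of \<open>1\<close> by the fraction \<open>t\<close> brings the
  \<open>A\<close>-component of both vectors \<open>1 \<plusminus> x - e\<close> into the unit ball, because \<open>p \<plusminus> x - p\<close> has norm
  less than 1.\<close>

lemma approximant_improve:
  assumes M: "M_ideal_in_u1 sc" and x: "norm x < 1" and \<epsilon>: "0 < \<epsilon>" "\<epsilon> \<le> 1"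
    and e: "N (x - e, 1) \<le> 1 + \<epsilon>" "N (- x - e, 1) \<le> 1 + \<epsilon>"
  shows "\<exists>e'. N (x - e', 1) \<le> 1 + \<epsilon>/2 \<and> N (- x - e', 1) \<le> 1 + \<epsilon>/2 \<and>
    norm (e' - e) \<le> 3 / (1 - norm x) * \<epsilon>"
proof -
  obtain p where p: "p \<in> annih2 sc"
    and p1: "\<And>w \<phi>. \<phi> \<in> D \<Longrightarrow> cmod (p \<phi> + \<phi> (w, 0)) \<le> N (w, 1) * dn \<phi>"
    and p2: "\<And>w t \<phi>. \<phi> \<in> D \<Longrightarrow>
       (\<And>\<psi>. \<psi> \<in> D \<Longrightarrow> cmod ((1 - t) * p \<psi> + \<psi> (w, 0)) \<le> dn \<psi>) \<Longrightarrow>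
       cmod (\<phi> (w, 1) - t * p \<phi>) \<le> dn \<phi>"
    using M_ideal_unit_projection[OF M] by blast
  define \<delta> where "\<delta> = 1 - norm x"
  \<comment> \<open>This \<open>t\<close> solves
    \<open>(1 - t) * (1 + \<epsilon>) + t * norm x = 1\<close>, see \<open>t_eq\<close>.\<close>
  define t where "t = \<epsilon> / (\<epsilon> + \<delta>)"
  have \<delta>: "\<delta> > 0" using x by (simp add: \<delta>_def)
  have t: "0 < t" "t < 1" using \<epsilon> \<delta> by (auto simp: t_def field_simps)
  have "t * (\<epsilon> + \<delta>) = \<epsilon>" using \<epsilon> \<delta> by (simp add: t_def)
  then have t_eq: "(1 - t) * (1 + \<epsilon>) + t * norm x = 1"
    by (simp add: \<delta>_def algebra_simps)
  define T where "T = complex_of_real t"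
  \<comment> \<open>The bipolar element \<open>t p\<close> will be replaced by some \<open>a\<close>
    in \<open>A\<close>, giving \<open>e' = (1 - t) *\<^sub>R e + a\<close>.\<close>
  let ?z = "\<lambda>\<phi>. T * p \<phi>"
  have z: "?z \<in> annih2 sc" using p B_times by (auto simp: annih2_def)
  have sub: "\<phi> (y - (1 - t) *\<^sub>R e, 0) = (1 - T) * \<phi> (y - e, 0) + T * \<phi> (y, 0)" if "\<phi> \<in> D" for \<phi> y
  proof -
    have "(y - (1 - t) *\<^sub>R e, 0 :: complex) = (1 - t) *\<^sub>R (y - e, 0) + t *\<^sub>R (y, 0)"
      by (simp add: algebra_simps)
    then have "\<phi> (y - (1 - t) *\<^sub>R e, 0) = \<phi> ((1 - t) *\<^sub>R (y - e, 0) + t *\<^sub>R (y, 0))"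
      by (rule arg_cong)
    then show ?thesis by (simp only: D_add[OF that] D_scaleR[OF that] T_def of_real_diff of_real_1)
  qed
  \<comment> \<open>Used for \<open>y = x\<close> and \<open>y = - x\<close>. With
    \<open>w = y - (1 - t) e\<close>, the vector \<open>(1 - t) p + w\<close> equals
    \<open>(1 - t) (p + y - e) + t y\<close>, whose norm is at most 1 by the choice of
    \<open>t\<close>.\<close>
  have ball: "cmod (\<phi> (y - (1 - t) *\<^sub>R e, 1) - T * p \<phi>) \<le> 1 * dn \<phi>"
    if y: "N (y - e, 1) \<le> 1 + \<epsilon>" "norm y = norm x" and \<phi>: "\<phi> \<in> D" for y \<phi>
  proof -
    have "cmod ((1 - T) * p \<psi> + \<psi> (y - (1 - t) *\<^sub>R e, 0)) \<le> dn \<psi>" if "\<psi> \<in> D" for \<psi>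
    proof -
      have "(1 - T) * p \<psi> + \<psi> (y - (1 - t) *\<^sub>R e, 0) =
          complex_of_real (1 - t) * (p \<psi> + \<psi> (y - e, 0)) + complex_of_real t * \<psi> (y, 0)"
        unfolding sub[OF that] by (simp add: T_def distrib_left)
      then have "cmod ((1 - T) * p \<psi> + \<psi> (y - (1 - t) *\<^sub>R e, 0)) \<le>
          cmod (complex_of_real (1 - t) * (p \<psi> + \<psi> (y - e, 0))) + cmod (complex_of_real t * \<psi> (y, 0))"
        by (simp only: norm_triangle_ineq)
      also have "\<dots> = (1 - t) * cmod (p \<psi> + \<psi> (y - e, 0)) + t * cmod (\<psi> (y, 0))"
        using t by (simp add: norm_mult del: of_real_diff)
      also have "\<dots> \<le> (1 - t) * ((1 + \<epsilon>) * dn \<psi>) + t * (norm x * dn \<psi>)"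
      proof (intro add_mono mult_left_mono)
        show "cmod (p \<psi> + \<psi> (y - e, 0)) \<le> (1 + \<epsilon>) * dn \<psi>"
          using p1[OF that, of "y - e"] mult_right_mono[OF y(1) dual_norm_nonneg[OF that]] by linarith
        show "cmod (\<psi> (y, 0)) \<le> norm x * dn \<psi>"
          using dual_norm_bound[OF that, of "(y, 0)"] by (simp add: N_embed y(2) mult.commute)
      qed (use t in auto)
      also have "\<dots> = ((1 - t) * (1 + \<epsilon>) + t * norm x) * dn \<psi>" by (simp add: algebra_simps)
      finally show ?thesis by (simp add: t_eq)
    qed
    then show ?thesis using p2[OF \<phi>] by simp
  qed
  \<comment> \<open>\<open>1 - e\<close> is the midpoint of \<open>1 + x - e\<close> and
    \<open>1 - x - e\<close>, and \<open>1 + \<epsilon> \<le> 2\<close>.\<close>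
  have "N (- e, 1) \<le> 2"
  proof -
    have "- e - e = 2 *\<^sub>R (- e)" by (simp add: scaleR_2)
    then have "(- e, 1 :: complex) = (1/2) *\<^sub>R (x - e, 1) + (1/2) *\<^sub>R (- x - e, 1)"
      by (simp add: scaleR_conv_of_real flip: scaleR_add_right)
    then have "N (- e, 1) \<le> N ((1/2) *\<^sub>R (x - e, 1)) + N ((1/2) *\<^sub>R (- x - e, 1))"
      using N_triangle by metis
    then show ?thesis
      using N_scaleR_le[of "1/2" "(x - e, 1)"] N_scaleR_le[of "1/2" "(- x - e, 1)"] e \<epsilon> by simp
  qed
  \<comment> \<open>The third ball controls the correction \<open>e' - e = a - t e\<close>. As
    \<open>p - e\<close> is the projection of \<open>1 - e\<close>, its norm is at most 2.\<close>
  then have third: "cmod (\<phi> (t *\<^sub>R e, 0) - T * p \<phi>) \<le> (t * 2) * dn \<phi>" if "\<phi> \<in> D" for \<phi>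
  proof -
    have "(t *\<^sub>R e, 0 :: complex) = (- t) *\<^sub>R (- e, 0)" by simp
    then have "\<phi> (t *\<^sub>R e, 0) - T * p \<phi> = - (T * (p \<phi> + \<phi> (- e, 0)))"
      using D_scaleR[OF that, of "- t" "(- e, 0)"] by (simp add: T_def algebra_simps)
    then have "cmod (\<phi> (t *\<^sub>R e, 0) - T * p \<phi>) = t * cmod (p \<phi> + \<phi> (- e, 0))"
      using t by (simp add: norm_mult T_def)
    also have "\<dots> \<le> t * (2 * dn \<phi>)"
      using p1[OF that, of "- e"] mult_right_mono[OF \<open>N (- e, 1) \<le> 2\<close> dual_norm_nonneg[OF that]] t
      by (intro mult_left_mono) auto
    finally show ?thesis by simp
  qed
  \<comment> \<open>Radii must be enlarged strictly, hence the factor 3 in place of 2.\<close>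
  have "t * 2 < 3 / \<delta> * \<epsilon>"
  proof -
    have "t \<le> \<epsilon> / \<delta>" unfolding t_def using \<epsilon> \<delta> by (intro divide_left_mono) auto
    moreover have "\<epsilon> / \<delta> > 0" using \<epsilon> \<delta> by simp
    ultimately show ?thesis by simp
  qed
  then have "\<exists>a. N ((x - (1 - t) *\<^sub>R e, 1) - (a, 0)) \<le> 1 + \<epsilon>/2 \<and>
      N ((- x - (1 - t) *\<^sub>R e, 1) - (a, 0)) \<le> 1 + \<epsilon>/2 \<and> N ((t *\<^sub>R e, 0) - (a, 0)) \<le> 3 / \<delta> * \<epsilon>"
    using \<epsilon> t e by (intro three_balls_meet_A[OF z, of 1 _ 1 _ "t * 2"] ball third) auto
  then obtain a where a: "N (x - (1 - t) *\<^sub>R e - a, 1) \<le> 1 + \<epsilon>/2"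
    "N (- x - (1 - t) *\<^sub>R e - a, 1) \<le> 1 + \<epsilon>/2" "norm (t *\<^sub>R e - a) \<le> 3 / \<delta> * \<epsilon>"
    by (auto simp: N_embed)
  show ?thesis
  proof (intro exI[of _ "(1 - t) *\<^sub>R e + a"] conjI)
    have "(1 - t) *\<^sub>R e + a - e = - (t *\<^sub>R e - a)" by (simp add: algebra_simps)
    then show "norm ((1 - t) *\<^sub>R e + a - e) \<le> 3 / (1 - norm x) * \<epsilon>"
      using a(3) by (simp only: norm_minus_cancel \<delta>_def)
  qed (use a in \<open>simp_all add: diff_diff_eq\<close>)
qed

text \<open>The improvement step is iterated with \<open>\<epsilon> = (1/2) ^ n\<close>. The
  corrections are dominated by a geometric series, so the approximants converge in \<open>A\<close>,
  and the bounds pass to the limit.\<close>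

lemma unit_ball_approximant:
  assumes M: "M_ideal_in_u1 sc" and x: "norm x < 1"
  shows "\<exists>e. N (x - e, 1) \<le> 1 \<and> N (- x - e, 1) \<le> 1"
proof -
  define C where "C = 3 / (1 - norm x)"
  let ?P = "\<lambda>n e. N (x - e, 1) \<le> 1 + (1/2) ^ n \<and> N (- x - e, 1) \<le> 1 + (1/2) ^ n"
  have "\<exists>e. \<forall>n. ?P n (e n) \<and> norm (e (Suc n) - e n) \<le> C * (1/2) ^ n"
  proof (rule dependent_nat_choice)
    \<comment> \<open>The start is \<open>e = 0\<close>: the bound at \<open>n = 0\<close> is 2,
      which covers \<open>1 + x\<close> and \<open>1 - x\<close>.\<close>
    have "N (y, 1) \<le> 1 + 1" if "norm y < 1" for y
      using N_triangle[of "(y, 0)" "(0, 1)"] N_one that by (simp add: N_embed)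
    from this[of x] this[of "- x"] show "\<exists>e. ?P 0 e"
      using x by (intro exI[of _ 0]) auto
  next
    fix e n assume "?P n e"
    then show "\<exists>e'. ?P (Suc n) e' \<and> norm (e' - e) \<le> C * (1/2) ^ n"
      using approximant_improve[OF M x, of "(1/2) ^ n" e] by (simp add: C_def power_le_one)
  qed
  then obtain e where e: "\<And>n. ?P n (e n)" "\<And>n. norm (e (Suc n) - e n) \<le> C * (1/2) ^ n" by blast
  have "summable (\<lambda>n. e (Suc n) - e n)"
    by (rule summable_comparison_test'[of "\<lambda>n. C * (1/2) ^ n" 0])
      (auto intro!: summable_mult summable_geometric e(2))
  then have "convergent (\<lambda>n. e n - e 0)"
    by (simp add: summable_iff_convergent sum_lessThan_telescope)
  then obtain l where "(\<lambda>n. e n - e 0) \<longlonglongrightarrow> l" by (auto simp: convergent_def)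
  then have "(\<lambda>n. e n - e 0 + e 0) \<longlonglongrightarrow> l + e 0" by (intro tendsto_intros)
  then have lim: "e \<longlonglongrightarrow> l + e 0" by simp
  \<comment> \<open>Replacing \<open>e n\<close> by its limit changes \<open>N\<close> by at most
    the norm distance, since \<open>A\<close> embeds isometrically.\<close>
  have "N (y - (l + e 0), 1) \<le> 1" if "\<And>n. N (y - e n, 1) \<le> 1 + (1/2) ^ n" for y
  proof (rule tendsto_lowerbound)
    have "(\<lambda>n. 1 + (1/2) ^ n + norm (e n - (l + e 0))) \<longlonglongrightarrow> 1 + 0 + norm (l + e 0 - (l + e 0))"
      by (intro tendsto_intros lim LIMSEQ_power_zero) auto
    then show "(\<lambda>n. 1 + (1/2) ^ n + norm (e n - (l + e 0))) \<longlonglongrightarrow> 1" by simp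
    show "\<forall>\<^sub>F n in sequentially. N (y - (l + e 0), 1) \<le> 1 + (1/2) ^ n + norm (e n - (l + e 0))"
    proof (intro always_eventually allI)
      fix n
      show "N (y - (l + e 0), 1) \<le> 1 + (1/2) ^ n + norm (e n - (l + e 0))"
        using N_triangle[of "(y - e n, 1)" "(e n - (l + e 0), 0)"] that[of n]
        unfolding add_Pair diff_add_cancel N_embed by (simp add: algebra_simps)
    qed
  qed simp
  from this[of x] this[of "- x"] e(1) show ?thesis by blast
qed

text \<open>A state sends \<open>1 - 2 a\<close> into the closed unit disc, and
  \<open>Re (1 - 2 z) \<le> 1\<close> means \<open>Re z \<ge> 0\<close>.\<close>

lemma half_F_subset_r: "half_F_set sc \<subseteq> r_set sc"
proof
  fix a assume "a \<in> half_F_set sc"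
  then have a: "N (- (2 *\<^sub>R a), 1) \<le> 1" by (simp add: half_F_set_def)
  show "a \<in> r_set sc"
    unfolding r_set_def
  proof (intro CollectI allI impI)
    fix \<phi> assume "u1_state sc \<phi>"
    then have \<phi>: "\<phi> \<in> D" "dn \<phi> = 1" "\<phi> (0, 1) = 1" by (auto simp: u1_state_def)
    have "(- (2 *\<^sub>R a), 1 :: complex) = (- 2) *\<^sub>R (a, 0) + (0, 1)" by simp
    then have "\<phi> (- (2 *\<^sub>R a), 1) = 1 - 2 * \<phi> (a, 0)"
      using D_add[OF \<phi>(1), of "(- 2) *\<^sub>R (a, 0)" "(0, 1)"] D_scaleR[OF \<phi>(1), of "- 2" "(a, 0)"] \<phi>(3)
      by simp
    then have "cmod (1 - 2 * \<phi> (a, 0)) \<le> 1" using dual_norm_upper[OF \<phi>(1) a] \<phi>(2) by simp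
    then have "Re (1 - 2 * \<phi> (a, 0)) \<le> 1" using complex_Re_le_cmod order_trans by blast
    then show "0 \<le> Re (\<phi> (a, 0))" by simp
  qed
qed

text \<open>For \<open>a = (s/2) (e - y)\<close>, the element \<open>1 - 2 a\<close> is the convex
  combination of \<open>1 + y - e\<close> and \<open>1\<close> with weights \<open>s\<close> and
  \<open>1 - s\<close>. The norm bound comes from \<open>e - y = 1 - (1 + y - e)\<close>, a
  difference of two elements of the unit ball.\<close>

lemma half_F_scaled:
  assumes "N (y - e, 1) \<le> 1" "0 \<le> s" "s \<le> 1"
  shows "(s/2) *\<^sub>R (e - y) \<in> half_F_set sc" "norm ((s/2) *\<^sub>R (e - y)) \<le> s"
proof -
  have "(- (2 *\<^sub>R (s/2) *\<^sub>R (e - y)), 1 :: complex) = s *\<^sub>R (y - e, 1) + (1 - s) *\<^sub>R (0, 1)"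
    by (simp add: algebra_simps scaleR_conv_of_real)
  then have "N (- (2 *\<^sub>R (s/2) *\<^sub>R (e - y)), 1) \<le> N (s *\<^sub>R (y - e, 1)) + N ((1 - s) *\<^sub>R (0, 1))"
    using N_triangle by metis
  also have "\<dots> \<le> s * N (y - e, 1) + (1 - s) * N (0, 1)"
    using N_scaleR_le[of s "(y - e, 1)"] N_scaleR_le[of "1 - s" "(0, 1)"] assms by simp
  also have "\<dots> \<le> s * 1 + (1 - s) * 1"
    using assms N_one by (intro add_mono mult_left_mono) auto
  finally show "(s/2) *\<^sub>R (e - y) \<in> half_F_set sc" by (simp add: half_F_set_def)
  have "norm (e - y) = N (- (y - e, 1) + (0, 1))" by (simp add: N_embed)
  also have "\<dots> \<le> 2" using N_triangle[of "- (y - e, 1)" "(0, 1)"] N_one assms(1)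
    by (simp add: N_uminus del: uminus_Pair)
  finally show "norm ((s/2) *\<^sub>R (e - y)) \<le> s" using assms mult_left_mono[of "norm (e - y)" 2 s] by simp
qed

end

theorem theorem6p1:
  fixes sc :: "complex \<Rightarrow> 'a::{real_normed_algebra,banach} \<Rightarrow> 'a"
  assumes "complex_banach_algebra sc"
    and "M_approx_unital sc"
    and "norm x < 1"
  shows "\<exists>a b. x = a - b \<and> a \<in> r_set sc \<and> b \<in> r_set sc \<and> norm a < 1 \<and> norm b < 1
           \<and> a \<in> half_F_set sc \<and> b \<in> half_F_set sc"
proof -
  interpret approx_unital_algebra sc
    using assms by unfold_locales (auto simp: M_approx_unital_def)
  have M: "M_ideal_in_u1 sc" using assms(2) by (simp add: M_approx_unital_def)
  \<comment> \<open>The gap between \<open>norm x\<close> and 1 is split: \<open>x / s\<close> still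
    has norm below 1, and the factor \<open>s\<close> later makes the norms of \<open>a\<close> and
    \<open>b\<close> strictly smaller than 1.\<close>
  obtain s where s: "norm x < s" "s < 1" using assms(3) dense by blast
  then have s0: "0 < s" by (meson norm_ge_zero order_le_less_trans)
  let ?y = "(1 / s) *\<^sub>R x"
  have "norm ?y < 1" using s s0 by simp
  then obtain e where e: "N (?y - e, 1) \<le> 1" "N (- ?y - e, 1) \<le> 1"
    using unit_ball_approximant[OF M] by blast
  \<comment> \<open>The two signs of \<open>?y\<close> share the same \<open>e\<close>, which
    therefore cancels in the difference and leaves \<open>s *\<^sub>R ?y = x\<close>.\<close>
  let ?a = "(s/2) *\<^sub>R (e - - ?y)" and ?b = "(s/2) *\<^sub>R (e - ?y)"
  have "?a - ?b = (s/2) *\<^sub>R (2 *\<^sub>R ?y)"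
    by (simp only: scaleR_2 scaleR_diff_right[symmetric]) simp
  then have "x = ?a - ?b" using s0 by simp
  moreover have "?a \<in> half_F_set sc" "?b \<in> half_F_set sc" "norm ?a \<le> s" "norm ?b \<le> s"
    using half_F_scaled[OF e(1)] half_F_scaled[OF e(2)] s s0 by auto
  ultimately show ?thesis using s half_F_subset_r
    by (intro exI[of _ ?a] exI[of _ ?b]) auto
qed

end
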